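(* Consider, for $\tau>0$, the optimization problems $$W=\inf_{u,w\ge 0,\ c\in\mathfrak{C}}\left\{-\lambda u+\eta w+\mu\ln\left(\int_\Xi e^{\frac{F(x,u,w,c)}{\mu}}p(x)\,\mathrm{d}x\right)\right\},\qquad W_\tau=\inf_{u,w\ge 0,\ c\in\mathfrak{C}}\left\{-\lambda u+\eta w+\mu\ln\left(\int_\Xi e^{\frac{F_\tau(x,u,w,c)}{\mu}}p(x)\,\mathrm{d}x\right)\right\}.$$ It follows that $W_\tau\to W$ as $\tau\to+0$. In addition, the minimizer of $W_\tau$ accumulates to a minimizer of $W$. Furthermore, $|W_\tau-W|\le C\tau$ with a constant $C>0$ independent from $\tau$.
   Context: Fix a constant $\underline{X}\ge 0$ and set $\Xi=(\underline{X},+\infty)$. $p$ is a measurable, nonnegative, bounded, continuous probability density function that is positive in $\Xi$, with $\int_\Xi p(x)\,\mathrm{d}x=1$. $L_p^2(\Xi)$ is the Hilbert space with norm $\|c\|=\sqrt{\int_\Xi c^2(x)p(x)\,\mathrm{d}x}$, and the admissible set is $\mathfrak{C}=\{c\mid c:\Xi\to[0,1],\ c\in L_p^2(\Xi)\}$ (measurable functions). Constants: $\alpha,\beta\in(0,1)$, $\hat{c}\in[0,1]$, $\lambda,\eta\ge 0$, $\mu>0$. The function $g:[0,1]\to[0,+\infty)$ is twice continuously differentiable, increasing, strictly convex, and Lipschitz continuous. For $u,w\ge 0$ and $c\in\mathfrak{C}$, $$F(x,u,w,c)=g(|c(x)-\hat{c}|)+\frac{\lambda}{\alpha}\max\{u-(1-c(x))x,0\}+\frac{\eta}{1-\beta}\max\{(1-c(x))x-w,0\},$$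 $$F_\tau(x,u,w,c)=g(|c(x)-\hat{c}|)+\frac{\lambda}{\alpha}m_\tau(u-(1-c(x))x)+\frac{\eta}{1-\beta}m_\tau((1-c(x))x-w),$$ where $m_\tau(y)=\frac{y+\sqrt{y^2+4\tau^2}}{2}$ for $y\in\mathbb{R}$, with regularization parameter $\tau>0$. "The minimizer of $W_\tau$" and "a minimizer of $W$" mean minimizers $(u,w,c)$ of the respective optimization problems. Standing assumption: $C_X=\frac{2\eta}{\mu(1-\beta)}>0$ is sufficiently small such that $\int_\Xi x^k e^{C_X x}p(x)\,\mathrm{d}x<+\infty$ for $k=0,1,2$.
   Formalization: If λ=0 the objectives do not depend on u, so minimizers of W_τ may have u→∞ as τ→+0 and need not accumulate; convergence of the u-component along a subsequence is therefore claimed only when λ>0 or the u-components are bounded. *)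

theory Defs
  imports "HOL-Analysis.Analysis"
begin

definition Xi :: "real \<Rightarrow> real set" where
  "Xi X = {X<..}"

(* Real-valued functions on Xi are encoded as functions on all reals; only their values on
   Xi are ever used. *)

definition L2p :: "real \<Rightarrow> (real \<Rightarrow> real) \<Rightarrow> (real \<Rightarrow> real) set" where
  "L2p X p = {c. set_borel_measurable lborel (Xi X) c \<and>
                 set_integrable lborel (Xi X) (\<lambda>x. (c x)\<^sup>2 * p x)}"

definition L2p_norm :: "real \<Rightarrow> (real \<Rightarrow> real) \<Rightarrow> (real \<Rightarrow> real) \<Rightarrow> real" where
  "L2p_norm X p c = sqrt (LINT x:Xi X|lborel. (c x)\<^sup>2 * p x)"

definition admissible :: "real \<Rightarrow> (real \<Rightarrow> real) \<Rightarrow> (real \<Rightarrow> real) set" where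
  "admissible X p = {c. c \<in> Xi X \<rightarrow> {0..1} \<and> c \<in> L2p X p}"

definition feasible :: "real \<Rightarrow> (real \<Rightarrow> real) \<Rightarrow> (real \<times> real \<times> (real \<Rightarrow> real)) set" where
  "feasible X p = {(u, w, c). 0 \<le> u \<and> 0 \<le> w \<and> c \<in> admissible X p}"

definition m_reg :: "real \<Rightarrow> real \<Rightarrow> real" where
  "m_reg \<tau> y = (y + sqrt (y\<^sup>2 + 4 * \<tau>\<^sup>2)) / 2"

definition F_fun :: "(real \<Rightarrow> real) \<Rightarrow> real \<Rightarrow> real \<Rightarrow> real \<Rightarrow> real \<Rightarrow> real \<Rightarrow>
    real \<Rightarrow> real \<Rightarrow> real \<Rightarrow> (real \<Rightarrow> real) \<Rightarrow> real" where
  "F_fun g chat \<alpha> \<beta> lam \<eta> x u w c =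
     g \<bar>c x - chat\<bar>
     + lam / \<alpha> * max (u - (1 - c x) * x) 0
     + \<eta> / (1 - \<beta>) * max ((1 - c x) * x - w) 0"

definition F_reg :: "(real \<Rightarrow> real) \<Rightarrow> real \<Rightarrow> real \<Rightarrow> real \<Rightarrow> real \<Rightarrow> real \<Rightarrow> real \<Rightarrow>
    real \<Rightarrow> real \<Rightarrow> real \<Rightarrow> (real \<Rightarrow> real) \<Rightarrow> real" where
  "F_reg g chat \<alpha> \<beta> lam \<eta> \<tau> x u w c =
     g \<bar>c x - chat\<bar>
     + lam / \<alpha> * m_reg \<tau> (u - (1 - c x) * x)
     + \<eta> / (1 - \<beta>) * m_reg \<tau> ((1 - c x) * x - w)"

fun objective :: "real \<Rightarrow> (real \<Rightarrow> real) \<Rightarrow> real \<Rightarrow> real \<Rightarrow> real \<Rightarrow>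
    (real \<Rightarrow> real \<Rightarrow> real \<Rightarrow> (real \<Rightarrow> real) \<Rightarrow> real) \<Rightarrow> real \<times> real \<times> (real \<Rightarrow> real) \<Rightarrow> real" where
  "objective X p lam \<eta> \<mu> G (u, w, c) =
     - lam * u + \<eta> * w + \<mu> * ln (LINT x:Xi X|lborel. exp (G x u w c / \<mu>) * p x)"

definition J :: "real \<Rightarrow> (real \<Rightarrow> real) \<Rightarrow> (real \<Rightarrow> real) \<Rightarrow> real \<Rightarrow> real \<Rightarrow> real \<Rightarrow> real \<Rightarrow> real \<Rightarrow>
    real \<Rightarrow> real \<times> real \<times> (real \<Rightarrow> real) \<Rightarrow> real" where
  "J X p g chat \<alpha> \<beta> lam \<eta> \<mu> = objective X p lam \<eta> \<mu> (F_fun g chat \<alpha> \<beta> lam \<eta>)"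

definition J_reg :: "real \<Rightarrow> (real \<Rightarrow> real) \<Rightarrow> (real \<Rightarrow> real) \<Rightarrow> real \<Rightarrow> real \<Rightarrow> real \<Rightarrow> real \<Rightarrow> real \<Rightarrow>
    real \<Rightarrow> real \<Rightarrow> real \<times> real \<times> (real \<Rightarrow> real) \<Rightarrow> real" where
  "J_reg X p g chat \<alpha> \<beta> lam \<eta> \<mu> \<tau> = objective X p lam \<eta> \<mu> (F_reg g chat \<alpha> \<beta> lam \<eta> \<tau>)"

(* Infima in the conditionally complete reals. By Jensen's inequality both objectives are
   at least - (lam / \<alpha>) * E[x] on the feasible set, so they are genuine infima. *)

definition W_val :: "real \<Rightarrow> (real \<Rightarrow> real) \<Rightarrow> (real \<Rightarrow> real) \<Rightarrow> real \<Rightarrow> real \<Rightarrow> real \<Rightarrow> real \<Rightarrow>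
    real \<Rightarrow> real \<Rightarrow> real" where
  "W_val X p g chat \<alpha> \<beta> lam \<eta> \<mu> =
     (INF z\<in>feasible X p. J X p g chat \<alpha> \<beta> lam \<eta> \<mu> z)"

definition W_reg :: "real \<Rightarrow> (real \<Rightarrow> real) \<Rightarrow> (real \<Rightarrow> real) \<Rightarrow> real \<Rightarrow> real \<Rightarrow> real \<Rightarrow> real \<Rightarrow>
    real \<Rightarrow> real \<Rightarrow> real \<Rightarrow> real" where
  "W_reg X p g chat \<alpha> \<beta> lam \<eta> \<mu> \<tau> =
     (INF z\<in>feasible X p. J_reg X p g chat \<alpha> \<beta> lam \<eta> \<mu> \<tau> z)"

definition minimizer_W :: "real \<Rightarrow> (real \<Rightarrow> real) \<Rightarrow> (real \<Rightarrow> real) \<Rightarrow> real \<Rightarrow> real \<Rightarrow> real \<Rightarrow> real \<Rightarrow>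
    real \<Rightarrow> real \<Rightarrow> real \<times> real \<times> (real \<Rightarrow> real) \<Rightarrow> bool" where
  "minimizer_W X p g chat \<alpha> \<beta> lam \<eta> \<mu> z \<longleftrightarrow>
     is_arg_min (J X p g chat \<alpha> \<beta> lam \<eta> \<mu>) (\<lambda>z. z \<in> feasible X p) z"

definition minimizer_W_reg :: "real \<Rightarrow> (real \<Rightarrow> real) \<Rightarrow> (real \<Rightarrow> real) \<Rightarrow> real \<Rightarrow> real \<Rightarrow> real \<Rightarrow>
    real \<Rightarrow> real \<Rightarrow> real \<Rightarrow> real \<Rightarrow> real \<times> real \<times> (real \<Rightarrow> real) \<Rightarrow> bool" where
  "minimizer_W_reg X p g chat \<alpha> \<beta> lam \<eta> \<mu> \<tau> z \<longleftrightarrow>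
     is_arg_min (J_reg X p g chat \<alpha> \<beta> lam \<eta> \<mu> \<tau>) (\<lambda>z. z \<in> feasible X p) z"

definition strictly_convex_on :: "real set \<Rightarrow> (real \<Rightarrow> real) \<Rightarrow> bool" where
  "strictly_convex_on S f \<longleftrightarrow> convex S \<and>
     (\<forall>s\<in>S. \<forall>t\<in>S. \<forall>\<theta>. s \<noteq> t \<and> 0 < \<theta> \<and> \<theta> < 1 \<longrightarrow>
        f ((1 - \<theta>) * s + \<theta> * t) < (1 - \<theta>) * f s + \<theta> * f t)"

(* Derivatives are taken within S, i.e. one-sided at the endpoints of an interval. *)

definition C2_on :: "real set \<Rightarrow> (real \<Rightarrow> real) \<Rightarrow> bool" where
  "C2_on S f \<longleftrightarrow> (\<exists>f' f''.
     (\<forall>t\<in>S. (f has_real_derivative f' t) (at t within S)) \<and>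
     (\<forall>t\<in>S. (f' has_real_derivative f'' t) (at t within S)) \<and>
     continuous_on S f'')"

definition C_X :: "real \<Rightarrow> real \<Rightarrow> real \<Rightarrow> real" where
  "C_X \<eta> \<mu> \<beta> = 2 * \<eta> / (\<mu> * (1 - \<beta>))"

end

theory Submission
  imports Defs "HOL-Probability.Probability_Measure"
begin

text \<open>
  Since \<open>max y 0 \<le> m_reg \<tau> y \<le> max y 0 + \<tau>\<close>, the regularized objective exceeds the original one by at
  most \<open>C * \<tau>\<close>, which gives the rate; moreover, minimizers of the regularized problems form a minimizing
  sequence of the original problem. As \<open>m_reg 0 y = max y 0\<close>, both problems belong to one family,
  and it remains to show that minimizing sequences converge along a subsequence. The coordinates \<open>u\<close>
  and \<open>w\<close> are bounded by coercivity (if \<open>lam = 0\<close>, the objective does not depend on \<open>u\<close>). By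
  compactness of the unit interval, the strictly convex penalty gains a fixed amount at the midpoint of
  two points at distance at least \<open>\<epsilon>\<close>. By AM-GM for the normalized exponentials, the objective at the
  midpoint of two feasible points then lies below the average of their objectives by a multiple of
  the probability that the controls differ by at least \<open>\<epsilon>\<close>. Hence the controls of a minimizing
  sequence are Cauchy in measure, and dominated convergence finishes the proof without weak compactness.
\<close>

section \<open>The smoothed positive part\<close>

lemma m_reg_zero [simp]: "m_reg 0 y = max y 0"
  by (simp add: m_reg_def max_def)

lemma m_reg_ge: "y \<le> m_reg \<tau> y" "0 \<le> m_reg \<tau> y"
proof -
  have "\<bar>y\<bar> \<le> sqrt (y\<^sup>2 + 4 * \<tau>\<^sup>2)"
    by (simp add: real_le_rsqrt)
  then show "y \<le> m_reg \<tau> y" "0 \<le> m_reg \<tau> y"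
    by (auto simp: m_reg_def)
qed

lemma m_reg_le:
  assumes "0 \<le> \<tau>" shows "m_reg \<tau> y \<le> max y 0 + \<tau>"
proof -
  have "y\<^sup>2 + 4 * \<tau>\<^sup>2 \<le> (\<bar>y\<bar> + 2 * \<tau>)\<^sup>2"
    using assms by (simp add: power2_sum power_mult_distrib)
  then have "sqrt (y\<^sup>2 + 4 * \<tau>\<^sup>2) \<le> \<bar>y\<bar> + 2 * \<tau>"
    using assms by (intro real_le_lsqrt) auto
  then show ?thesis
    by (auto simp: m_reg_def)
qed

text \<open>The root in \<open>m_reg \<tau> y\<close> is the Euclidean norm of the vector (y, 2
  \<tau>), so midpoint convexity is the triangle inequality in the plane.\<close>

lemma m_reg_midpoint: "m_reg \<tau> ((y + z) / 2) \<le> (m_reg \<tau> y + m_reg \<tau> z) / 2"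
proof -
  have "sqrt ((y / 2 + z / 2)\<^sup>2 + (\<tau> + \<tau>)\<^sup>2)
      \<le> sqrt ((y / 2)\<^sup>2 + \<tau>\<^sup>2) + sqrt ((z / 2)\<^sup>2 + \<tau>\<^sup>2)"
    by (rule real_sqrt_sum_squares_triangle_ineq)
  moreover have "sqrt ((y / 2)\<^sup>2 + \<tau>\<^sup>2) = sqrt (y\<^sup>2 + 4 * \<tau>\<^sup>2) / 2" for y
  proof -
    have "(y / 2)\<^sup>2 + \<tau>\<^sup>2 = (y\<^sup>2 + 4 * \<tau>\<^sup>2) / 4" by (simp add: field_simps)
    then show ?thesis by (simp only: real_sqrt_divide real_sqrt_four)
  qed
  moreover have "(\<tau> + \<tau>)\<^sup>2 = 4 * \<tau>\<^sup>2" by (simp add: power2_eq_square)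
  ultimately show ?thesis
    by (simp add: m_reg_def add_divide_distrib)
qed

lemma continuous_m_reg [continuous_intros]:
  "continuous_on S f \<Longrightarrow> continuous_on S (\<lambda>x. m_reg \<tau> (f x))"
  unfolding m_reg_def by (intro continuous_intros) auto

lemma tendsto_m_reg [tendsto_intros]:
  "(f \<longlongrightarrow> l) F \<Longrightarrow> ((\<lambda>x. m_reg \<tau> (f x)) \<longlongrightarrow> m_reg \<tau> l) F"
  unfolding m_reg_def by (intro tendsto_intros) auto

lemma measurable_m_reg [measurable]:
  "f \<in> borel_measurable M \<Longrightarrow> (\<lambda>x. m_reg \<tau> (f x)) \<in> borel_measurable M"
  by (rule measurable_compose[OF _ borel_measurable_continuous_onI])
    (auto intro!: continuous_intros)

section \<open>Tools: a uniform convexity gap and almost everywhere convergent subsequences\<close>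

text \<open>The midpoint gap of \<open>h\<close> is continuous and positive on the compact set
  \<open>K\<close> of pairs at distance at least \<open>\<epsilon>\<close>, so its minimum over
  \<open>K\<close> serves as \<open>\<delta>\<close>.\<close>

lemma strict_midconvex_modulus:
  fixes h :: "real \<Rightarrow> real"
  assumes cont: "continuous_on {0..1} h"
    and mid: "\<And>s t. s \<in> {0..1} \<Longrightarrow> t \<in> {0..1} \<Longrightarrow> s \<noteq> t \<Longrightarrow> h ((s + t) / 2) < (h s + h t) / 2"
    and "\<epsilon> > 0"
  shows "\<exists>\<delta>>0. \<forall>s\<in>{0..1}. \<forall>t\<in>{0..1}. \<epsilon> \<le> \<bar>s - t\<bar> \<longrightarrow> h ((s + t) / 2) \<le> (h s + h t) / 2 - \<delta>"
proof -
  define K where "K = ({0..1} \<times> {0..1}) \<inter> {z. \<epsilon> \<le> \<bar>fst z - snd z :: real\<bar>}"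
  define f where "f = (\<lambda>z. (h (fst z) + h (snd z)) / 2 - h ((fst z + snd z) / 2))"
  have "closed {z. \<epsilon> \<le> \<bar>fst z - snd z :: real\<bar>}"
    by (intro closed_Collect_le continuous_intros)
  then have "compact K"
    unfolding K_def by (intro compact_Int_closed compact_Times) auto
  moreover have "continuous_on K f"
    unfolding f_def by (intro continuous_intros continuous_on_compose2[OF cont]) (auto simp: K_def)
  ultimately have "K = {} \<or> (\<exists>z\<in>K. \<forall>y\<in>K. f z \<le> f y)"
    using continuous_attains_inf by blast
  then show ?thesis
  proof
    \<comment> \<open>This happens when \<open>\<epsilon> > 1\<close>; no pair qualifies and any
      positive \<open>\<delta>\<close> will do.\<close>
    assume "K = {}"
    then have "\<not> \<epsilon> \<le> \<bar>s - t\<bar>" if "s \<in> {0..1}" "t \<in> {0..1}" for s t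
      using that by (force simp: K_def)
    then show ?thesis
      by (intro exI[of _ 1]) auto
  next
    assume "\<exists>z\<in>K. \<forall>y\<in>K. f z \<le> f y"
    then obtain z where z: "z \<in> K" "\<And>y. y \<in> K \<Longrightarrow> f z \<le> f y" by blast
    have "f z > 0"
      using z(1) mid[of "fst z" "snd z"] \<open>\<epsilon> > 0\<close> by (auto simp: f_def K_def)
    moreover have "h ((s + t) / 2) \<le> (h s + h t) / 2 - f z"
      if "s \<in> {0..1}" "t \<in> {0..1}" "\<epsilon> \<le> \<bar>s - t\<bar>" for s t
      using z(2)[of "(s, t)"] that by (auto simp: f_def K_def)
    ultimately show ?thesis
      by blast
  qed
qed

text \<open>The argument of Riesz and Fischer: along a subsequence whose consecutive L1 distances
  are at most \<open>(1 / 2) ^ k\<close>, the increments have an almost everywhere finite absolute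
  sum.\<close>

lemma (in finite_measure) AE_convergent_subseq:
  fixes c :: "nat \<Rightarrow> 'a \<Rightarrow> real"
  assumes int: "\<And>n. integrable M (c n)"
    and cauchy: "\<And>\<epsilon>. \<epsilon> > 0 \<Longrightarrow> \<exists>N. \<forall>m\<ge>N. \<forall>n\<ge>N. (\<integral>x. \<bar>c m x - c n x\<bar> \<partial>M) \<le> \<epsilon>"
  obtains r :: "nat \<Rightarrow> nat" where "strict_mono r" "AE x in M. convergent (\<lambda>k. c (r k) x)"
proof -
  have "\<exists>N. \<forall>k. \<forall>m\<ge>N k. \<forall>n\<ge>N k. (\<integral>x. \<bar>c m x - c n x\<bar> \<partial>M) \<le> (1 / 2) ^ k"
    by (intro choice allI cauchy) simp
  then obtain N where N: "\<And>k m n. N k \<le> m \<Longrightarrow> N k \<le> n \<Longrightarrow> (\<integral>x. \<bar>c m x - c n x\<bar> \<partial>M) \<le> (1 / 2) ^ k"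
    by blast
  \<comment> \<open>The summand \<open>k\<close> makes \<open>r\<close> strictly increasing, and the
    sum over \<open>N\<close> keeps \<open>r k\<close> at or above \<open>N k\<close>.\<close>
  define r where "r = (\<lambda>k. k + (\<Sum>i\<le>k. N i))"
  have mono: "strict_mono r"
    unfolding r_def by (intro strict_monoI_Suc) simp
  have ge: "N k \<le> r k" for k
    unfolding r_def by (intro trans_le_add2 member_le_sum) auto
  define d where "d = (\<lambda>k x. \<bar>c (r (Suc k)) x - c (r k) x\<bar>)"
  have d_int: "integrable M (d k)" for k
    unfolding d_def by (intro integrable_abs Bochner_Integration.integrable_diff int)
  have [measurable]: "d k \<in> borel_measurable M" for k
    using d_int by (rule borel_measurable_integrable)
  have d_le: "(\<integral>\<^sup>+x. ennreal (d k x) \<partial>M) \<le> ennreal ((1 / 2) ^ k)" for k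
  proof -
    have "N k \<le> r (Suc k)"
      using ge[of k] strict_mono_mono[OF mono] by (meson le_SucI le_refl monoD order_trans)
    then have "(\<integral>x. d k x \<partial>M) \<le> (1 / 2) ^ k"
      unfolding d_def using N ge by blast
    moreover have "(\<integral>\<^sup>+x. ennreal (d k x) \<partial>M) = ennreal (\<integral>x. d k x \<partial>M)"
      by (intro nn_integral_eq_integral d_int) (simp add: d_def)
    ultimately show ?thesis
      by (simp add: ennreal_leI)
  qed
  have "(\<integral>\<^sup>+x. (\<Sum>k. ennreal (d k x)) \<partial>M) = (\<Sum>k. \<integral>\<^sup>+x. ennreal (d k x) \<partial>M)"
    by (intro nn_integral_suminf) measurable
  also have "\<dots> \<le> (\<Sum>k. ennreal ((1 / 2) ^ k))"
    by (intro suminf_le d_le) auto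
  also have "\<dots> = ennreal (\<Sum>k. (1 / 2) ^ k)"
    by (intro suminf_ennreal2 summable_geometric) auto
  finally have "(\<integral>\<^sup>+x. (\<Sum>k. ennreal (d k x)) \<partial>M) \<noteq> \<infinity>"
    by (auto simp: top_unique)
  then have "AE x in M. (\<Sum>k. ennreal (d k x)) \<noteq> \<infinity>"
    by (intro nn_integral_PInf_AE) auto
  then have "AE x in M. convergent (\<lambda>k. c (r k) x)"
  proof eventually_elim
    case (elim x)
    then have "summable (\<lambda>k. d k x)"
      by (intro summable_suminf_not_top) (auto simp: d_def)
    then have "summable (\<lambda>k. c (r (Suc k)) x - c (r k) x)"
      unfolding d_def by (rule summable_rabs_cancel)
    \<comment> \<open>The partial sums telescope to \<open>c (r n) x - c (r 0) x\<close>, which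
      carries convergence over to the subsequence.\<close>
    then have "convergent (\<lambda>n. \<Sum>k<n. c (r (Suc k)) x - c (r k) x)"
      by (simp add: summable_iff_convergent)
    then have "convergent (\<lambda>n. c (r n) x - c (r 0) x)"
      by (simp only: sum_lessThan_telescope[where f = "\<lambda>k. c (r k) x"])
    then have "convergent (\<lambda>n. (c (r n) x - c (r 0) x) + c (r 0) x)"
      by (intro convergent_add convergent_const)
    then show ?case by simp
  qed
  with mono show thesis by (rule that)
qed

section \<open>The problem over a probability measure\<close>

text \<open>The density is absorbed into \<open>P\<close>, and \<open>h\<close> stands for the
  penalty \<open>g \<bar>s - chat\<bar>\<close>, extended continuously to the whole line. Strict
  convexity enters as a midpoint inequality. The exponent in \<open>exp_integrable\<close> matches
  the largest possible growth of the loss in \<open>x\<close>.\<close>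

locale hedging_problem = prob_space P for P :: "real measure" +
  fixes h :: "real \<Rightarrow> real" and \<alpha> \<beta> lam \<eta> \<mu> :: real
  assumes sets_P [measurable_cong]: "sets P = sets borel"
    and AE_nonneg: "AE x in P. 0 \<le> x"
    and h_cont: "continuous_on UNIV h"
    and h_nonneg: "\<And>s. 0 \<le> h s"
    and h_midpoint: "\<And>s t. s \<in> {0..1} \<Longrightarrow> t \<in> {0..1} \<Longrightarrow> s \<noteq> t \<Longrightarrow>
          h ((s + t) / 2) < (h s + h t) / 2"
    and alpha: "0 < \<alpha>" "\<alpha> < 1"
    and beta: "\<beta> < 1"
    and lam: "0 \<le> lam"
    and eta: "0 < \<eta>"
    and mu: "0 < \<mu>"
    and exp_integrable: "integrable P (\<lambda>x. exp (\<eta> / (1 - \<beta>) * x / \<mu>))"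
begin

text \<open>Controls are total Borel functions with values in the unit interval everywhere, so that
  pointwise estimates hold without restriction to the support of \<open>P\<close>.\<close>

definition adm :: "(real \<Rightarrow> real) set" where
  "adm = {c. c \<in> borel_measurable borel \<and> (\<forall>x. c x \<in> {0..1})}"

definition loss :: "real \<Rightarrow> real \<Rightarrow> real \<Rightarrow> (real \<Rightarrow> real) \<Rightarrow> real \<Rightarrow> real" where
  "loss \<tau> u w c x = h (c x) + lam / \<alpha> * m_reg \<tau> (u - (1 - c x) * x)
     + \<eta> / (1 - \<beta>) * m_reg \<tau> ((1 - c x) * x - w)"

text \<open>In the language of statistical mechanics, the normalizing constant of the Gibbs density
  proportional to \<open>exp (loss \<tau> u w c x / \<mu>)\<close>.\<close>

definition partition_fun :: "real \<Rightarrow> real \<Rightarrow> real \<Rightarrow> (real \<Rightarrow> real) \<Rightarrow> real" where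
  "partition_fun \<tau> u w c = (\<integral>x. exp (loss \<tau> u w c x / \<mu>) \<partial>P)"

definition obj :: "real \<Rightarrow> real \<Rightarrow> real \<Rightarrow> (real \<Rightarrow> real) \<Rightarrow> real" where
  "obj \<tau> u w c = - lam * u + \<eta> * w + \<mu> * ln (partition_fun \<tau> u w c)"

lemma admD: "c \<in> adm \<Longrightarrow> c \<in> borel_measurable borel" "c \<in> adm \<Longrightarrow> 0 \<le> c x" "c \<in> adm \<Longrightarrow> c x \<le> 1"
  by (auto simp: adm_def)

lemma coeffs_nonneg: "0 \<le> lam / \<alpha>" "0 < \<eta> / (1 - \<beta>)"
  using alpha beta lam eta by auto

lemma h_measurable [measurable]: "h \<in> borel_measurable borel"
  using h_cont by (rule borel_measurable_continuous_onI)

lemma measurable_P: "c \<in> adm \<Longrightarrow> c \<in> borel_measurable P"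
  using admD(1) measurable_cong_sets[OF sets_P] by blast

lemma loss_measurable:
  assumes "c \<in> adm"
  shows "loss \<tau> u w c \<in> borel_measurable P"
proof -
  note [measurable] = measurable_P[OF assms]
  show ?thesis
    unfolding loss_def by measurable
qed

lemma loss_nonneg: "0 \<le> loss \<tau> u w c x"
  unfolding loss_def using h_nonneg coeffs_nonneg m_reg_ge(2)
  by (intro add_nonneg_nonneg mult_nonneg_nonneg) auto

text \<open>For fixed \<open>x\<close> the arguments of both \<open>m_reg\<close> terms are affine
  in \<open>u\<close>, \<open>w\<close> and \<open>c x\<close>, so midpoint convexity of
  \<open>m_reg\<close> handles them and the gap comes from \<open>h\<close>. The free
  \<open>\<delta>\<close> may depend on \<open>x\<close>: it will be zero where the two controls are
  close.\<close>

lemma loss_midpoint: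
  assumes "h ((c x + d x) / 2) \<le> (h (c x) + h (d x)) / 2 - \<delta>"
  shows "loss \<tau> ((u + u') / 2) ((w + w') / 2) (\<lambda>x. (c x + d x) / 2) x
    \<le> (loss \<tau> u w c x + loss \<tau> u' w' d x) / 2 - \<delta>"
proof -
  let ?p = "\<lambda>c. (1 - c x) * x" and ?m = "\<lambda>x. (c x + d x) / 2"
  have "(u + u') / 2 - ?p ?m = ((u - ?p c) + (u' - ?p d)) / 2"
    "?p ?m - (w + w') / 2 = ((?p c - w) + (?p d - w')) / 2"
    by (simp_all add: field_simps)
  then have "m_reg \<tau> ((u + u') / 2 - ?p ?m) \<le> (m_reg \<tau> (u - ?p c) + m_reg \<tau> (u' - ?p d)) / 2"
    "m_reg \<tau> (?p ?m - (w + w') / 2) \<le> (m_reg \<tau> (?p c - w) + m_reg \<tau> (?p d - w')) / 2"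
    by (simp_all only: m_reg_midpoint)
  then have "loss \<tau> ((u + u') / 2) ((w + w') / 2) ?m x
      \<le> ((h (c x) + h (d x)) / 2 - \<delta>)
        + lam / \<alpha> * ((m_reg \<tau> (u - ?p c) + m_reg \<tau> (u' - ?p d)) / 2)
        + \<eta> / (1 - \<beta>) * ((m_reg \<tau> (?p c - w) + m_reg \<tau> (?p d - w')) / 2)"
    unfolding loss_def using assms coeffs_nonneg by (intro add_mono mult_left_mono) auto
  also have "\<dots> = (loss \<tau> u w c x + loss \<tau> u' w' d x) / 2 - \<delta>"
    unfolding loss_def by algebra
  finally show ?thesis .
qed

lemma h_le_midpoint:
  assumes "s \<in> {0..1}" "t \<in> {0..1}" shows "h ((s + t) / 2) \<le> (h s + h t) / 2"
  using h_midpoint[OF assms] by (cases "s = t") auto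

text \<open>Since \<open>(1 - c x) * x\<close> lies between 0 and \<open>x\<close> almost
  everywhere, the loss is at most a constant plus \<open>\<eta> / (1 - \<beta>) * x\<close>. A
  larger \<open>w\<close> only lowers the loss, hence the bound is uniform in \<open>w\<close> as
  well as in \<open>c\<close> and in \<open>u\<close> up to \<open>U\<close>.\<close>

lemma envelope:
  assumes "0 \<le> \<tau>"
  obtains G where "integrable P G"
    "\<And>u w c. 0 \<le> u \<Longrightarrow> u \<le> U \<Longrightarrow> 0 \<le> w \<Longrightarrow> c \<in> adm \<Longrightarrow> AE x in P. exp (loss \<tau> u w c x / \<mu>) \<le> G x"
proof -
  have "\<exists>s\<in>{0..1}. \<forall>t\<in>{0..1}. h t \<le> h s"
    by (intro continuous_attains_sup continuous_on_subset[OF h_cont]) auto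
  then obtain s where s: "\<And>t. t \<in> {0..1} \<Longrightarrow> h t \<le> h s" by blast
  define K where "K = h s + lam / \<alpha> * (U + \<tau>) + \<eta> / (1 - \<beta>) * \<tau>"
  define G where "G = (\<lambda>x. exp (K / \<mu>) * exp (\<eta> / (1 - \<beta>) * x / \<mu>))"
  have "integrable P G"
    unfolding G_def by (intro integrable_mult_right exp_integrable)
  moreover have "AE x in P. exp (loss \<tau> u w c x / \<mu>) \<le> G x"
    if *: "0 \<le> u" "u \<le> U" "0 \<le> w" "c \<in> adm" for u w c
    using AE_nonneg
  proof eventually_elim
    case (elim x)
    have c: "0 \<le> c x" "c x \<le> 1"
      using admD[OF *(4)] by auto
    then have cx: "0 \<le> (1 - c x) * x" "(1 - c x) * x \<le> x"
      using elim by (auto simp: mult_left_le_one_le)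
    have "m_reg \<tau> (u - (1 - c x) * x) \<le> U + \<tau>"
      using m_reg_le[OF assms, of "u - (1 - c x) * x"] cx * by linarith
    moreover have "m_reg \<tau> ((1 - c x) * x - w) \<le> x + \<tau>"
      using m_reg_le[OF assms, of "(1 - c x) * x - w"] cx * elim by linarith
    ultimately have "loss \<tau> u w c x \<le> h s + lam / \<alpha> * (U + \<tau>) + \<eta> / (1 - \<beta>) * (x + \<tau>)"
      unfolding loss_def using coeffs_nonneg s[of "c x"] c
      by (intro add_mono mult_left_mono) auto
    also have "\<dots> = K + \<eta> / (1 - \<beta>) * x"
      by (simp add: K_def distrib_left)
    finally have "exp (loss \<tau> u w c x / \<mu>) \<le> exp ((K + \<eta> / (1 - \<beta>) * x) / \<mu>)"
      using mu by (simp add: divide_right_mono)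
    then show ?case
      by (simp add: G_def exp_add add_divide_distrib)
  qed
  ultimately show thesis by (rule that)
qed

lemma exp_loss_integrable:
  assumes "0 \<le> \<tau>" "0 \<le> u" "0 \<le> w" "c \<in> adm"
  shows "integrable P (\<lambda>x. exp (loss \<tau> u w c x / \<mu>))"
proof -
  obtain G where G: "integrable P G"
    "\<And>v w c. 0 \<le> v \<Longrightarrow> v \<le> u \<Longrightarrow> 0 \<le> w \<Longrightarrow> c \<in> adm \<Longrightarrow> AE x in P. exp (loss \<tau> v w c x / \<mu>) \<le> G x"
    using envelope[OF \<open>0 \<le> \<tau>\<close>] by blast
  note [measurable] = loss_measurable[OF \<open>c \<in> adm\<close>, of \<tau> u w]
  show ?thesis
  proof (rule Bochner_Integration.integrable_bound[OF G(1)])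
    show "AE x in P. norm (exp (loss \<tau> u w c x / \<mu>)) \<le> norm (G x)"
      using G(2)[OF assms(2) order_refl assms(3,4)] by eventually_elim auto
  qed measurable
qed

text \<open>The loss is nonnegative and \<open>P\<close> has mass 1. The bound justifies the
  logarithms of \<open>partition_fun\<close> and the divisions by it below.\<close>

lemma partition_fun_ge_1:
  assumes "0 \<le> \<tau>" "0 \<le> u" "0 \<le> w" "c \<in> adm"
  shows "1 \<le> partition_fun \<tau> u w c"
proof -
  have "(\<integral>x. 1 \<partial>P) \<le> partition_fun \<tau> u w c"
    unfolding partition_fun_def using mu loss_nonneg
    by (intro integral_mono exp_loss_integrable assms) auto
  then show ?thesis by (simp add: prob_space)
qed

text \<open>Smoothing raises the loss by an amount between 0 and
  \<open>(lam / \<alpha> + \<eta> / (1 - \<beta>)) * \<tau>\<close>. The corresponding constant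
  factor leaves the integral, and the logarithm turns it back into a summand.\<close>

lemma obj_regularization_bounds:
  assumes "0 \<le> \<tau>" "0 \<le> u" "0 \<le> w" "c \<in> adm"
  shows "obj 0 u w c \<le> obj \<tau> u w c"
    and "obj \<tau> u w c \<le> obj 0 u w c + (lam / \<alpha> + \<eta> / (1 - \<beta>)) * \<tau>"
proof -
  let ?K = "(lam / \<alpha> + \<eta> / (1 - \<beta>)) * \<tau>"
  note pos = partition_fun_ge_1[OF _ assms(2-4)]
  have "loss 0 u w c x \<le> loss \<tau> u w c x" for x
    unfolding loss_def using coeffs_nonneg m_reg_ge
    by (intro add_mono mult_left_mono) (auto simp: max_def)
  then have "partition_fun 0 u w c \<le> partition_fun \<tau> u w c"
    unfolding partition_fun_def using mu assms
    by (intro integral_mono exp_loss_integrable) (auto simp: divide_right_mono)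
  then show "obj 0 u w c \<le> obj \<tau> u w c"
    unfolding obj_def using pos[of 0] mu by simp
  have "loss \<tau> u w c x \<le> h (c x) + lam / \<alpha> * (max (u - (1 - c x) * x) 0 + \<tau>)
     + \<eta> / (1 - \<beta>) * (max ((1 - c x) * x - w) 0 + \<tau>)" for x
    unfolding loss_def using coeffs_nonneg m_reg_le[OF assms(1)]
    by (intro add_mono mult_left_mono) auto
  also have "\<dots> x = loss 0 u w c x + ?K" for x
    by (simp add: loss_def algebra_simps)
  finally have "exp (loss \<tau> u w c x / \<mu>) \<le> exp (?K / \<mu>) * exp (loss 0 u w c x / \<mu>)" for x
    using mu by (simp add: exp_add[symmetric] add_divide_distrib[symmetric] divide_right_mono add.commute)
  then have "partition_fun \<tau> u w c \<le> (\<integral>x. exp (?K / \<mu>) * exp (loss 0 u w c x / \<mu>) \<partial>P)"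
    unfolding partition_fun_def using assms
    by (intro integral_mono exp_loss_integrable integrable_mult_right) auto
  also have "\<dots> = exp (?K / \<mu>) * partition_fun 0 u w c"
    by (simp add: partition_fun_def)
  finally have "ln (partition_fun \<tau> u w c) \<le> ln (exp (?K / \<mu>) * partition_fun 0 u w c)"
    using pos[of \<tau>] assms(1) by (intro ln_mono) auto
  also have "\<dots> = ?K / \<mu> + ln (partition_fun 0 u w c)"
    using pos[of 0] by (simp add: ln_mult)
  finally have "\<mu> * ln (partition_fun \<tau> u w c) \<le> \<mu> * (?K / \<mu> + ln (partition_fun 0 u w c))"
    using mu by simp
  then show "obj \<tau> u w c \<le> obj 0 u w c + ?K"
    unfolding obj_def using mu by (simp add: distrib_left)
qed

section \<open>Coercivity and quantitative midpoint convexity\<close>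

text \<open>Almost everywhere \<open>u - x \<le> m_reg \<tau> (u - (1 - c x) * x)\<close>, so the
  integral inherits the factor \<open>exp (lam / \<alpha> * u / \<mu>)\<close>, which the logarithm
  turns into the term in \<open>u\<close>. The constant \<open>b\<close> is independent of the point
  and of \<open>\<tau>\<close>.\<close>

lemma obj_coercive:
  obtains b where
    "\<And>\<tau> u w c. 0 \<le> \<tau> \<Longrightarrow> 0 \<le> u \<Longrightarrow> 0 \<le> w \<Longrightarrow> c \<in> adm \<Longrightarrow>
       (lam / \<alpha> - lam) * u + \<eta> * w + b \<le> obj \<tau> u w c"
proof -
  let ?f = "\<lambda>x. exp (- (lam / \<alpha> * x) / \<mu>)"
  have f_int: "integrable P ?f"
  proof (rule Bochner_Integration.integrable_bound)
    show "AE x in P. norm (?f x) \<le> norm (1::real)"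
      using AE_nonneg
    proof eventually_elim
      case (elim x)
      then have "0 \<le> lam / \<alpha> * x" using coeffs_nonneg by (intro mult_nonneg_nonneg)
      then have "- (lam / \<alpha> * x) / \<mu> \<le> 0" using mu by (intro divide_nonpos_pos) auto
      then show ?case by simp
    qed
  qed auto
  define B where "B = (\<integral>x. ?f x \<partial>P)"
  \<comment> \<open>A strictly positive integrand cannot have integral zero over a probability
    measure; positivity of \<open>B\<close> gives \<open>ln B\<close> its meaning.\<close>
  have "B \<noteq> 0"
  proof
    assume "B = 0"
    then have "AE x in P. ?f x = 0"
      unfolding B_def using f_int by (subst (asm) integral_nonneg_eq_0_iff_AE) auto
    then have "AE x in P. False" by simp
    then show False by simp
  qed
  moreover have "0 \<le> B" unfolding B_def by (rule Bochner_Integration.integral_nonneg) simp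
  ultimately have B: "0 < B" by simp
  show thesis
  proof (rule that[of "\<mu> * ln B"])
    fix \<tau> u w :: real and c
    assume *: "0 \<le> \<tau>" "0 \<le> u" "0 \<le> w" "c \<in> adm"
    have "AE x in P. exp (lam / \<alpha> * u / \<mu>) * ?f x \<le> exp (loss \<tau> u w c x / \<mu>)"
      using AE_nonneg
    proof eventually_elim
      case (elim x)
      then have "(1 - c x) * x \<le> x"
        using admD[OF *(4)] by (auto simp: mult_left_le_one_le)
      then have "u - x \<le> m_reg \<tau> (u - (1 - c x) * x)"
        using m_reg_ge(1)[of "u - (1 - c x) * x" \<tau>] by linarith
      then have "0 + lam / \<alpha> * (u - x) + 0 \<le> loss \<tau> u w c x"
        unfolding loss_def using coeffs_nonneg h_nonneg m_reg_ge(2)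
        by (intro add_mono mult_left_mono mult_nonneg_nonneg) auto
      then have "lam / \<alpha> * u + - (lam / \<alpha> * x) \<le> loss \<tau> u w c x"
        by (simp add: right_diff_distrib)
      then show ?case
        using mu by (simp only: exp_add[symmetric] add_divide_distrib[symmetric])
          (simp add: divide_right_mono)
    qed
    then have "(\<integral>x. exp (lam / \<alpha> * u / \<mu>) * ?f x \<partial>P) \<le> partition_fun \<tau> u w c"
      unfolding partition_fun_def using *
      by (intro integral_mono_AE integrable_mult_right f_int exp_loss_integrable)
    then have "exp (lam / \<alpha> * u / \<mu>) * B \<le> partition_fun \<tau> u w c"
      by (simp add: B_def)
    then have "ln (exp (lam / \<alpha> * u / \<mu>) * B) \<le> ln (partition_fun \<tau> u w c)"
      using B by (intro ln_mono) auto
    then have "lam / \<alpha> * u / \<mu> + ln B \<le> ln (partition_fun \<tau> u w c)"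
      using B by (simp add: ln_mult)
    then have "\<mu> * (lam / \<alpha> * u / \<mu> + ln B) \<le> \<mu> * ln (partition_fun \<tau> u w c)"
      using mu by simp
    then show "(lam / \<alpha> - lam) * u + \<eta> * w + \<mu> * ln B \<le> obj \<tau> u w c"
      unfolding obj_def using mu by (simp add: algebra_simps)
  qed
qed

lemma midpoint_adm: "c \<in> adm \<Longrightarrow> d \<in> adm \<Longrightarrow> (\<lambda>x. (c x + d x) / 2) \<in> adm"
  by (auto simp: adm_def intro!: add_nonneg_nonneg) (smt (verit) field_sum_of_halves)

text \<open>This is the Cauchy-Schwarz proof that the log-exponential integral is convex, carried
  out through AM-GM so that the pointwise gap of \<open>h\<close> survives integration. The constant
  \<open>\<kappa>\<close> is fixed before the two points, so the estimate is uniform in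
  them.\<close>

lemma obj_midpoint:
  assumes "0 \<le> \<tau>" "0 < \<epsilon>"
  obtains \<kappa> where "0 < \<kappa>"
    "\<And>u w c u' w' d. 0 \<le> u \<Longrightarrow> 0 \<le> w \<Longrightarrow> c \<in> adm \<Longrightarrow> 0 \<le> u' \<Longrightarrow> 0 \<le> w' \<Longrightarrow> d \<in> adm \<Longrightarrow>
       obj \<tau> ((u + u') / 2) ((w + w') / 2) (\<lambda>x. (c x + d x) / 2)
         \<le> (obj \<tau> u w c + obj \<tau> u' w' d) / 2
           - \<kappa> * prob {x \<in> space P. \<epsilon> \<le> \<bar>c x - d x\<bar>}
               / sqrt (partition_fun \<tau> u w c * partition_fun \<tau> u' w' d)"
proof -
  have "\<exists>\<delta>>0. \<forall>s\<in>{0..1}. \<forall>t\<in>{0..1}. \<epsilon> \<le> \<bar>s - t\<bar> \<longrightarrow> h ((s + t) / 2) \<le> (h s + h t) / 2 - \<delta>"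
  proof (rule strict_midconvex_modulus)
    show "continuous_on {0..1} h" using h_cont by (rule continuous_on_subset) simp
  qed (fact h_midpoint assms(2))+
  then obtain \<delta> where \<delta>: "\<delta> > 0"
    "\<And>s t. s \<in> {0..1} \<Longrightarrow> t \<in> {0..1} \<Longrightarrow> \<epsilon> \<le> \<bar>s - t\<bar> \<Longrightarrow> h ((s + t) / 2) \<le> (h s + h t) / 2 - \<delta>"
    by blast
  \<comment> \<open>A drop of the loss by \<open>\<delta>\<close> multiplies its exponential by
    \<open>1 - k\<close>.\<close>
  define k where "k = 1 - exp (- \<delta> / \<mu>)"
  have k: "0 < k" "k \<le> 1" using \<delta>(1) mu by (auto simp: k_def)
  show thesis
  proof (rule that[of "\<mu> * k"])
    show "0 < \<mu> * k" using k mu by simp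
    fix u w u' w' :: real and c d
    assume z: "0 \<le> u" "0 \<le> w" "c \<in> adm" and z': "0 \<le> u'" "0 \<le> w'" "d \<in> adm"
    note [measurable] = measurable_P[OF z(3)] measurable_P[OF z'(3)]
    let ?E = "{x \<in> space P. \<epsilon> \<le> \<bar>c x - d x\<bar>}"
    let ?m = "\<lambda>x. (c x + d x) / 2"
    let ?A = "partition_fun \<tau> u w c" and ?B = "partition_fun \<tau> u' w' d"
    let ?M = "partition_fun \<tau> ((u + u') / 2) ((w + w') / 2) ?m"
    \<comment> \<open>The geometric mean of the two integrals: \<open>ln s\<close> is the average of
      their logarithms, the quantity to be compared with \<open>ln ?M\<close>.\<close>
    define s where "s = sqrt (?A * ?B)"
    note int = exp_loss_integrable[OF assms(1)]
    note ge1 = partition_fun_ge_1[OF assms(1)]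
    have A: "1 \<le> ?A" "1 \<le> ?B" using ge1[OF z] ge1[OF z'] by auto
    then have s: "0 < s" by (simp add: s_def)
    have M: "1 \<le> ?M" using z z' by (intro ge1 midpoint_adm) auto
    have pt: "exp (loss \<tau> ((u + u') / 2) ((w + w') / 2) ?m x / \<mu>)
      \<le> s / (2 * ?A) * exp (loss \<tau> u w c x / \<mu>) + s / (2 * ?B) * exp (loss \<tau> u' w' d x / \<mu>)
        - k * indicator ?E x" (is "?l \<le> ?r") if x: "x \<in> space P" for x
    proof -
      let ?a = "loss \<tau> u w c x" and ?b = "loss \<tau> u' w' d x"
      let ?i = "indicator ?E x :: real"
      have cd: "c x \<in> {0..1}" "d x \<in> {0..1}"
        using admD[OF z(3)] admD[OF z'(3)] by auto
      have "h ((c x + d x) / 2) \<le> (h (c x) + h (d x)) / 2 - \<delta> * ?i"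
        using \<delta>(2)[OF cd] h_le_midpoint[OF cd] by (auto simp: indicator_def)
      then have "?l \<le> exp (((?a + ?b) / 2 - \<delta> * ?i) / \<mu>)"
        using loss_midpoint mu by (simp add: divide_right_mono)
      also have "\<dots> = exp ((?a + ?b) / (2 * \<mu>)) * exp (- \<delta> / \<mu> * ?i)"
        by (simp add: exp_add[symmetric] diff_divide_distrib)
      also have "exp (- \<delta> / \<mu> * ?i) = 1 - k * ?i"
        by (simp add: k_def indicator_def)
      also have "exp ((?a + ?b) / (2 * \<mu>)) * (1 - k * ?i)
          = exp ((?a + ?b) / (2 * \<mu>)) - k * ?i * exp ((?a + ?b) / (2 * \<mu>))"
        by (simp add: algebra_simps)
      \<comment> \<open>The exponential is at least 1 as the loss is nonnegative, so the
        multiplicative saving \<open>k\<close> yields an additive saving of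
        \<open>k\<close>.\<close>
      also have "\<dots> \<le> exp ((?a + ?b) / (2 * \<mu>)) - k * ?i * 1"
      proof (intro diff_left_mono mult_left_mono)
        show "1 \<le> exp ((?a + ?b) / (2 * \<mu>))"
          using mu loss_nonneg by simp
        show "0 \<le> k * ?i" using k by simp
      qed
      also have "exp ((?a + ?b) / (2 * \<mu>)) = sqrt (exp (?a / \<mu>) * exp (?b / \<mu>))"
      proof -
        have "exp (?a / \<mu>) * exp (?b / \<mu>) = exp (2 * ((?a + ?b) / (2 * \<mu>)))"
          by (simp add: exp_add[symmetric] add_divide_distrib)
        also have "\<dots> = (exp ((?a + ?b) / (2 * \<mu>)))\<^sup>2"
          by (rule exp_double)
        finally show ?thesis by simp
      qed
      \<comment> \<open>Normalizing both factors before AM-GM makes the two resulting terms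
        integrate to \<open>s / 2\<close> each.\<close>
      also have "exp (?a / \<mu>) * exp (?b / \<mu>) = (?A * ?B) * ((exp (?a / \<mu>) / ?A) * (exp (?b / \<mu>) / ?B))"
        using A by simp
      also have "sqrt \<dots> = s * sqrt ((exp (?a / \<mu>) / ?A) * (exp (?b / \<mu>) / ?B))"
        unfolding s_def by (rule real_sqrt_mult)
      also have "\<dots> - k * ?i * 1 \<le> s * ((exp (?a / \<mu>) / ?A + exp (?b / \<mu>) / ?B) / 2) - k * ?i * 1"
        using A s by (intro diff_right_mono mult_left_mono arith_geo_mean_sqrt) auto
      also have "s * ((exp (?a / \<mu>) / ?A + exp (?b / \<mu>) / ?B) / 2)
          = s / (2 * ?A) * exp (?a / \<mu>) + s / (2 * ?B) * exp (?b / \<mu>)"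
        by (simp add: add_divide_distrib distrib_left)
      finally show ?thesis by simp
    qed
    have E: "?E \<in> sets P" by measurable
    then have ind: "integrable P (\<lambda>x. indicator ?E x :: real)"
      by (intro integrable_real_indicator) (auto simp: emeasure_eq_measure)
    have "?M \<le> (\<integral>x. s / (2 * ?A) * exp (loss \<tau> u w c x / \<mu>)
        + s / (2 * ?B) * exp (loss \<tau> u' w' d x / \<mu>) - k * indicator ?E x \<partial>P)"
      unfolding partition_fun_def[of _ _ _ ?m] using z z' pt
      by (intro integral_mono int midpoint_adm Bochner_Integration.integrable_diff
          Bochner_Integration.integrable_add integrable_mult_right ind) auto
    also have "\<dots> = s / (2 * ?A) * ?A + s / (2 * ?B) * ?B - k * prob ?E"
      using int[OF z] int[OF z'] ind E by (simp add: partition_fun_def)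
    also have "\<dots> = s - k * prob ?E"
      using A by simp
    finally have "?M - s \<le> - (k * prob ?E)" by simp
    then have "(?M - s) / s \<le> - (k * prob ?E) / s"
      using s by (intro divide_right_mono) auto
    then have "(?M - s) / s \<le> - (k * prob ?E / s)" by simp
    \<comment> \<open>The tangent of the logarithm at \<open>s\<close> turns the gap between the
      integrals into a gap between the objectives.\<close>
    moreover have "ln ?M - ln s \<le> (?M - s) / s"
      using M s by (intro ln_diff_le) auto
    moreover have "ln s = (ln ?A + ln ?B) / 2"
      using A by (simp add: s_def ln_sqrt ln_mult)
    ultimately have "ln ?M \<le> (ln ?A + ln ?B) / 2 - k * prob ?E / s"
      by linarith
    then have "\<mu> * ln ?M \<le> \<mu> * ((ln ?A + ln ?B) / 2 - k * prob ?E / s)"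
      using mu by simp
    also have "\<dots> = (\<mu> * ln ?A + \<mu> * ln ?B) / 2 - \<mu> * k * prob ?E / s"
      by (simp add: right_diff_distrib distrib_left)
    finally have "\<mu> * ln ?M \<le> (\<mu> * ln ?A + \<mu> * ln ?B) / 2 - \<mu> * k * prob ?E / s" .
    moreover have "- lam * ((u + u') / 2) + \<eta> * ((w + w') / 2)
        = ((- lam * u + \<eta> * w) + (- lam * u' + \<eta> * w')) / 2"
      by (simp add: field_simps)
    ultimately show "obj \<tau> ((u + u') / 2) ((w + w') / 2) ?m
        \<le> (obj \<tau> u w c + obj \<tau> u' w' d) / 2 - \<mu> * k * prob ?E / sqrt (?A * ?B)"
      unfolding obj_def s_def[symmetric] by argo
  qed
qed

section \<open>Compactness of minimizing sequences\<close>

text \<open>As \<open>\<alpha> < 1\<close>, the growth \<open>lam / \<alpha> * u\<close> in the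
  lower bound outweighs the reward \<open>lam * u\<close>; for \<open>lam > 0\<close> this is the
  source of boundedness in \<open>u\<close>.\<close>

lemma coeff_gap: "0 \<le> lam / \<alpha> - lam" "lam > 0 \<Longrightarrow> 0 < lam / \<alpha> - lam"
proof -
  have "\<alpha> * lam \<le> lam" using lam alpha by (simp add: mult_left_le_one_le)
  then show "0 \<le> lam / \<alpha> - lam" using alpha by (simp add: pos_le_divide_eq mult.commute)
  show "0 < lam / \<alpha> - lam" if "lam > 0"
    using alpha that by (simp add: pos_less_divide_eq)
qed

text \<open>Dominated convergence with \<open>envelope\<close> as majorant, which is why the
  \<open>u n\<close> have a common bound \<open>U\<close>; the limit of the integrals is at least 1,
  where the logarithm is continuous.\<close>

lemma tendsto_obj:
  assumes \<tau>: "0 \<le> \<tau>"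
    and z: "\<And>n. 0 \<le> u n" "\<And>n. u n \<le> U" "\<And>n. 0 \<le> w n" "\<And>n. c n \<in> adm" "c' \<in> adm"
    and u: "u \<longlonglongrightarrow> u'" and w: "w \<longlonglongrightarrow> w'"
    and c: "AE x in P. (\<lambda>n. c n x) \<longlonglongrightarrow> c' x"
  shows "(\<lambda>n. obj \<tau> (u n) (w n) (c n)) \<longlonglongrightarrow> obj \<tau> u' w' c'"
proof -
  obtain G where G: "integrable P G"
    "\<And>u w c. 0 \<le> u \<Longrightarrow> u \<le> U \<Longrightarrow> 0 \<le> w \<Longrightarrow> c \<in> adm \<Longrightarrow> AE x in P. exp (loss \<tau> u w c x / \<mu>) \<le> G x"
    using envelope[OF \<tau>] by blast
  have h_lim: "((\<lambda>n. h (f n)) \<longlongrightarrow> h l) sequentially" if "f \<longlonglongrightarrow> l" for f l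
    using h_cont that by (simp add: continuous_on_eq_continuous_within isCont_tendsto_compose)
  note [measurable] = loss_measurable[OF z(4)] loss_measurable[OF z(5)]
  have "(\<lambda>n. partition_fun \<tau> (u n) (w n) (c n)) \<longlonglongrightarrow> partition_fun \<tau> u' w' c'"
    unfolding partition_fun_def
  proof (rule integral_dominated_convergence[OF _ _ G(1)])
    show "AE x in P. (\<lambda>n. exp (loss \<tau> (u n) (w n) (c n) x / \<mu>)) \<longlonglongrightarrow> exp (loss \<tau> u' w' c' x / \<mu>)"
      using c
    proof eventually_elim
      case (elim x)
      then show ?case
        unfolding loss_def using mu by (intro tendsto_intros h_lim u w) auto
    qed
    show "AE x in P. norm (exp (loss \<tau> (u n) (w n) (c n) x / \<mu>)) \<le> G x" for n
      using G(2)[OF z(1-4)] by simp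
  qed measurable
  moreover have "partition_fun \<tau> u' w' c' \<noteq> 0"
    using partition_fun_ge_1[OF \<tau> LIMSEQ_le_const[OF u] LIMSEQ_le_const[OF w] z(5)] z(1,3) by fastforce
  ultimately show ?thesis
    unfolding obj_def by (intro tendsto_intros u w)
qed

text \<open>The value at the midpoint of two almost minimal points cannot drop below the infimum, so the
  strict midpoint convexity forces their third components to be close in measure.\<close>

lemma minimizing_sequence_L1_Cauchy:
  assumes \<tau>: "0 \<le> \<tau>"
    and z: "\<And>n. 0 \<le> u n" "\<And>n. u n \<le> U" "\<And>n. 0 \<le> w n" "\<And>n. c n \<in> adm"
    and lower: "\<And>u w c. 0 \<le> u \<Longrightarrow> 0 \<le> w \<Longrightarrow> c \<in> adm \<Longrightarrow> m \<le> obj \<tau> u w c"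
    and lim: "(\<lambda>n. obj \<tau> (u n) (w n) (c n)) \<longlonglongrightarrow> m"
    and e: "0 < e"
  shows "\<exists>N. \<forall>i\<ge>N. \<forall>j\<ge>N. (\<integral>x. \<bar>c i x - c j x\<bar> \<partial>P) \<le> e"
proof -
  obtain G where G: "integrable P G"
    "\<And>u w c. 0 \<le> u \<Longrightarrow> u \<le> U \<Longrightarrow> 0 \<le> w \<Longrightarrow> c \<in> adm \<Longrightarrow> AE x in P. exp (loss \<tau> u w c x / \<mu>) \<le> G x"
    using envelope[OF \<tau>] by blast
  define S where "S = (\<integral>x. G x \<partial>P)"
  let ?A = "\<lambda>n. partition_fun \<tau> (u n) (w n) (c n)"
  have A: "1 \<le> ?A n" "?A n \<le> S" for n
    using partition_fun_ge_1[OF \<tau> z(1,3,4)] G z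
    by (auto simp: S_def partition_fun_def intro!: integral_mono_AE exp_loss_integrable \<tau>)
  then have S: "0 < S" by (metis less_le_trans zero_less_one)
  \<comment> \<open>The upper bound makes the gain in \<open>obj_midpoint\<close> uniform along the
    sequence.\<close>
  have sqrtA: "0 < sqrt (?A i * ?A j)" "sqrt (?A i * ?A j) \<le> S" for i j
  proof -
    have "0 < ?A i" "0 < ?A j" using A by (auto intro: less_le_trans[OF zero_less_one])
    then show "0 < sqrt (?A i * ?A j)" by simp
    have "?A i * ?A j \<le> S * S"
      using A[of i] A[of j] S by (intro mult_mono) auto
    then show "sqrt (?A i * ?A j) \<le> S"
      using S by (intro real_le_lsqrt) (auto simp: power2_eq_square)
  qed
  obtain \<kappa> where \<kappa>: "0 < \<kappa>"
    "\<And>u w c u' w' d. 0 \<le> u \<Longrightarrow> 0 \<le> w \<Longrightarrow> c \<in> adm \<Longrightarrow> 0 \<le> u' \<Longrightarrow> 0 \<le> w' \<Longrightarrow> d \<in> adm \<Longrightarrow>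
       obj \<tau> ((u + u') / 2) ((w + w') / 2) (\<lambda>x. (c x + d x) / 2)
         \<le> (obj \<tau> u w c + obj \<tau> u' w' d) / 2
           - \<kappa> * prob {x \<in> space P. e / 2 \<le> \<bar>c x - d x\<bar>}
               / sqrt (partition_fun \<tau> u w c * partition_fun \<tau> u' w' d)"
    using obj_midpoint[OF \<tau> half_gt_zero[OF e]] by blast
  \<comment> \<open>The threshold for near-minimality: the gain guaranteed when the controls differ
    by at least \<open>e / 2\<close> on a set of probability \<open>e / 2\<close>.\<close>
  have "0 < \<kappa> * (e / 2) / S" using \<kappa> e S by simp
  with order_tendstoD(2)[OF lim, of "m + \<kappa> * (e / 2) / S"]
  obtain N where N: "\<And>n. N \<le> n \<Longrightarrow> obj \<tau> (u n) (w n) (c n) - m < \<kappa> * (e / 2) / S"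
    by (auto simp: eventually_sequentially algebra_simps)
  have "(\<integral>x. \<bar>c i x - c j x\<bar> \<partial>P) \<le> e" if "N \<le> i" "N \<le> j" for i j
  proof -
    note [measurable] = measurable_P[OF z(4)]
    let ?E = "{x \<in> space P. e / 2 \<le> \<bar>c i x - c j x\<bar>}"
    have "m \<le> obj \<tau> ((u i + u j) / 2) ((w i + w j) / 2) (\<lambda>x. (c i x + c j x) / 2)"
      using z by (intro lower midpoint_adm) auto
    also have "\<dots> \<le> (obj \<tau> (u i) (w i) (c i) + obj \<tau> (u j) (w j) (c j)) / 2
        - \<kappa> * prob ?E / sqrt (?A i * ?A j)"
      by (intro \<kappa> z)
    finally have le: "m \<le> (obj \<tau> (u i) (w i) (c i) + obj \<tau> (u j) (w j) (c j)) / 2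
        - \<kappa> * prob ?E / sqrt (?A i * ?A j)" .
    have average: "y \<le> b" if "m \<le> (s + t) / 2 - y" "s - m < b" "t - m < b" for s t y b :: real
      using that by (simp add: field_simps)
    have "\<kappa> * prob ?E / sqrt (?A i * ?A j) \<le> \<kappa> * (e / 2) / S"
      using le N[OF that(1)] N[OF that(2)] by (rule average)
    moreover have "\<kappa> * prob ?E / S \<le> \<kappa> * prob ?E / sqrt (?A i * ?A j)"
      using sqrtA \<kappa> S by (intro divide_left_mono) auto
    ultimately have "\<kappa> * prob ?E / S \<le> \<kappa> * (e / 2) / S" by (rule order_trans[rotated])
    then have "\<kappa> / S * prob ?E \<le> \<kappa> / S * (e / 2)" by simp
    then have E: "prob ?E \<le> e / 2"
      using \<kappa>(1) S by (simp only: mult_le_cancel_left_pos divide_pos_pos)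
    have cc: "\<bar>c i x - c j x\<bar> \<le> 1" for x
      using admD(2,3)[OF z(4)[of i], of x] admD(2,3)[OF z(4)[of j], of x] by linarith
    have "?E \<in> sets P" by measurable
    then have ind: "integrable P (\<lambda>x. indicator ?E x :: real)"
      by (intro integrable_real_indicator) (auto simp: emeasure_eq_measure)
    \<comment> \<open>Off \<open>?E\<close> the controls differ by less than \<open>e / 2\<close>,
      on \<open>?E\<close> by at most 1.\<close>
    have "(\<integral>x. \<bar>c i x - c j x\<bar> \<partial>P) \<le> (\<integral>x. e / 2 + indicator ?E x \<partial>P)"
    proof (rule integral_mono)
      show "integrable P (\<lambda>x. \<bar>c i x - c j x\<bar>)"
        using cc by (intro integrable_const_bound[where B = 1]) auto
      show "integrable P (\<lambda>x. e / 2 + indicator ?E x :: real)"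
        by (intro Bochner_Integration.integrable_add ind) auto
      show "\<bar>c i x - c j x\<bar> \<le> e / 2 + indicator ?E x" if "x \<in> space P" for x
        using that cc[of x] e by (auto simp: indicator_def)
    qed
    also have "\<dots> = e / 2 + prob ?E"
      using \<open>?E \<in> sets P\<close> by (subst Bochner_Integration.integral_add[OF _ ind]) (auto simp: prob_space)
    finally show ?thesis using E by linarith
  qed
  then show ?thesis by blast
qed

text \<open>Bolzano-Weierstrass for \<open>u\<close> and \<open>w\<close>, then an almost everywhere
  convergent subsequence of the controls; \<open>tendsto_obj\<close> identifies the value at the
  limit as \<open>m\<close>.\<close>

lemma bounded_minimizing_sequence:
  assumes \<tau>: "0 \<le> \<tau>"
    and z: "\<And>n. 0 \<le> u n" "\<And>n. u n \<le> U" "\<And>n. 0 \<le> w n" "\<And>n. w n \<le> U" "\<And>n. c n \<in> adm"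
    and lower: "\<And>u w c. 0 \<le> u \<Longrightarrow> 0 \<le> w \<Longrightarrow> c \<in> adm \<Longrightarrow> m \<le> obj \<tau> u w c"
    and lim: "(\<lambda>n. obj \<tau> (u n) (w n) (c n)) \<longlonglongrightarrow> m"
  obtains r u' w' c' where "strict_mono (r :: nat \<Rightarrow> nat)" "0 \<le> u'" "0 \<le> w'" "c' \<in> adm"
    "obj \<tau> u' w' c' = m" "(u \<circ> r) \<longlonglongrightarrow> u'" "(w \<circ> r) \<longlonglongrightarrow> w'"
    "AE x in P. (\<lambda>n. c (r n) x) \<longlonglongrightarrow> c' x"
proof -
  have "seq_compact ({0..U} \<times> {0..U})"
    by (intro compact_imp_seq_compact compact_Times) auto
  then obtain l r0 where r0: "strict_mono r0" "((\<lambda>n. (u n, w n)) \<circ> r0) \<longlonglongrightarrow> l"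
    by (rule seq_compactE[where f = "\<lambda>n. (u n, w n)"]) (use z in auto)
  from tendsto_fst[OF r0(2)] tendsto_snd[OF r0(2)]
  have uw: "(u \<circ> r0) \<longlonglongrightarrow> fst l" "(w \<circ> r0) \<longlonglongrightarrow> snd l"
    by (simp_all add: o_def)
  have c_int: "integrable P (c n)" for n
    using admD[OF z(5)] by (intro integrable_const_bound[where B = 1] measurable_P z) auto
  obtain r1 where r1: "strict_mono r1" "AE x in P. convergent (\<lambda>k. c (r0 (r1 k)) x)"
  proof (rule AE_convergent_subseq[of "\<lambda>n. c (r0 n)"])
    show "\<exists>N. \<forall>i\<ge>N. \<forall>j\<ge>N. (\<integral>x. \<bar>c (r0 i) x - c (r0 j) x\<bar> \<partial>P) \<le> e" if e: "0 < e" for e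
    proof -
      have "\<exists>N. \<forall>i\<ge>N. \<forall>j\<ge>N. (\<integral>x. \<bar>c i x - c j x\<bar> \<partial>P) \<le> e"
        by (rule minimizing_sequence_L1_Cauchy[OF \<tau> z(1-3,5) _ lim e]) (rule lower)
      then obtain N where N: "\<And>i j. N \<le> i \<Longrightarrow> N \<le> j \<Longrightarrow> (\<integral>x. \<bar>c i x - c j x\<bar> \<partial>P) \<le> e"
        by auto
      have "N \<le> r0 i" if "N \<le> i" for i
        using that seq_suble[OF r0(1), of i] by (rule order_trans)
      then show ?thesis
        by (intro exI[of _ N] allI impI N)
    qed
  qed (use c_int in auto)
  define r where "r = r0 \<circ> r1"
  have r: "strict_mono r" unfolding r_def by (intro strict_mono_o r0 r1)
  \<comment> \<open>\<open>lim\<close> is unspecified where the sequence diverges. Clipping to the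
    unit interval puts \<open>c'\<close> into \<open>adm\<close> and changes nothing where the limit
    exists.\<close>
  define c' where "c' = (\<lambda>x. max 0 (min 1 (lim (\<lambda>k. c (r k) x))))"
  note [measurable] = admD(1)[OF z(5)]
  have c': "c' \<in> adm"
    unfolding adm_def c'_def by (auto intro!: borel_measurable_max borel_measurable_min)
  have lim_c: "AE x in P. (\<lambda>n. c (r n) x) \<longlonglongrightarrow> c' x"
    using r1(2)
  proof eventually_elim
    case (elim x)
    then have l: "(\<lambda>n. c (r n) x) \<longlonglongrightarrow> lim (\<lambda>k. c (r k) x)"
      by (simp add: r_def convergent_LIMSEQ_iff)
    moreover have "0 \<le> lim (\<lambda>k. c (r k) x)" "lim (\<lambda>k. c (r k) x) \<le> 1"
      using admD[OF z(5)] by (auto intro: LIMSEQ_le_const[OF l] LIMSEQ_le_const2[OF l])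
    ultimately show ?case by (simp add: c'_def)
  qed
  have u: "(u \<circ> r) \<longlonglongrightarrow> fst l" and w: "(w \<circ> r) \<longlonglongrightarrow> snd l"
    unfolding r_def o_assoc by (intro LIMSEQ_subseq_LIMSEQ uw r1)+
  have nonneg: "0 \<le> fst l" "0 \<le> snd l"
    using z by (auto intro: LIMSEQ_le_const[OF u] LIMSEQ_le_const[OF w])
  have "obj \<tau> (fst l) (snd l) c' = m"
  proof (rule LIMSEQ_unique)
    show "(\<lambda>n. obj \<tau> ((u \<circ> r) n) ((w \<circ> r) n) (c (r n))) \<longlonglongrightarrow> obj \<tau> (fst l) (snd l) c'"
      using z by (intro tendsto_obj[where U = U] \<tau> u w c' lim_c) auto
    show "(\<lambda>n. obj \<tau> ((u \<circ> r) n) ((w \<circ> r) n) (c (r n))) \<longlonglongrightarrow> m"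
      using LIMSEQ_subseq_LIMSEQ[OF lim r] by (simp add: o_def)
  qed
  then show thesis
    using r nonneg c' u w lim_c by (intro that[of r "fst l" "snd l" c'])
qed

text \<open>Coercivity replaces the assumed bounds: it controls \<open>w\<close> because
  \<open>\<eta> > 0\<close>, and \<open>u\<close> if \<open>lam > 0\<close>. For
  \<open>lam = 0\<close> the objective ignores \<open>u\<close>, so an unbounded \<open>u\<close>
  may diverge; hence the condition on its convergence.\<close>

lemma minimizing_sequence:
  assumes \<tau>: "0 \<le> \<tau>"
    and z: "\<And>n. 0 \<le> u n" "\<And>n. 0 \<le> w n" "\<And>n. c n \<in> adm"
    and lower: "\<And>u w c. 0 \<le> u \<Longrightarrow> 0 \<le> w \<Longrightarrow> c \<in> adm \<Longrightarrow> m \<le> obj \<tau> u w c"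
    and lim: "(\<lambda>n. obj \<tau> (u n) (w n) (c n)) \<longlonglongrightarrow> m"
  obtains r u' w' c' where "strict_mono (r :: nat \<Rightarrow> nat)" "0 \<le> u'" "0 \<le> w'" "c' \<in> adm"
    "obj \<tau> u' w' c' = m" "lam > 0 \<or> Bseq u \<Longrightarrow> (u \<circ> r) \<longlonglongrightarrow> u'" "(w \<circ> r) \<longlonglongrightarrow> w'"
    "AE x in P. (\<lambda>n. c (r n) x) \<longlonglongrightarrow> c' x"
proof -
  \<comment> \<open>In the remaining case, \<open>lam = 0\<close> with \<open>u\<close> unbounded,
    the constant 0 takes the place of \<open>u\<close>; no objective value changes.\<close>
  define v where "v = (\<lambda>n. if lam > 0 \<or> Bseq u then u n else 0)"
  have obj_v: "obj \<tau> (v n) (w n) (c n) = obj \<tau> (u n) (w n) (c n)" for n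
  proof (cases "lam > 0")
    case False
    with lam have "lam = 0" by simp
    then show ?thesis unfolding obj_def partition_fun_def loss_def by simp
  qed (simp add: v_def)
  have v0: "0 \<le> v n" for n using z by (simp add: v_def)
  obtain b where b: "\<And>\<tau> u w c. 0 \<le> \<tau> \<Longrightarrow> 0 \<le> u \<Longrightarrow> 0 \<le> w \<Longrightarrow> c \<in> adm \<Longrightarrow>
       (lam / \<alpha> - lam) * u + \<eta> * w + b \<le> obj \<tau> u w c"
    using obj_coercive by blast
  from lim have "Bseq (\<lambda>n. obj \<tau> (u n) (w n) (c n))"
    by (intro convergent_imp_Bseq convergentI)
  then obtain K where "\<And>n. \<bar>obj \<tau> (u n) (w n) (c n)\<bar> \<le> K"
    by (auto simp: Bseq_def)
  then have K: "obj \<tau> (u n) (w n) (c n) \<le> K" for n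
    by (rule abs_le_D1)
  have coer: "(lam / \<alpha> - lam) * u n + \<eta> * w n \<le> K - b" for n
    using b[OF \<tau> z(1,2,3), of n n n] K[of n] by linarith
  have w_le: "w n \<le> (K - b) / \<eta>" for n
  proof -
    have "0 \<le> (lam / \<alpha> - lam) * u n" using coeff_gap z by (intro mult_nonneg_nonneg)
    then have "\<eta> * w n \<le> K - b" using coer[of n] by linarith
    then show ?thesis using eta by (simp add: pos_le_divide_eq mult.commute)
  qed
  obtain V where V: "\<And>n. v n \<le> V"
  proof (cases "lam > 0")
    case True
    have "v n \<le> (K - b) / (lam / \<alpha> - lam)" for n
    proof -
      have "0 \<le> \<eta> * w n" using eta z by simp
      then have "(lam / \<alpha> - lam) * u n \<le> K - b" using coer[of n] by linarith
      then show ?thesis using coeff_gap(2)[OF True] True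
        by (simp add: v_def pos_le_divide_eq mult.commute)
    qed
    then show ?thesis by (rule that)
  next
    case nlam: False
    show ?thesis
    proof (cases "Bseq u")
      case True
      then obtain V where "\<And>n. \<bar>u n\<bar> \<le> V"
        by (auto simp: Bseq_def)
      then have "u n \<le> V" for n by (rule abs_le_D1)
      with True show ?thesis by (intro that[of V]) (simp add: v_def)
    next
      case False
      with nlam show ?thesis by (intro that[of 0]) (simp add: v_def)
    qed
  qed
  have v_eq: "v = u" if "lam > 0 \<or> Bseq u"
    unfolding v_def using that by auto
  show thesis
  proof (rule bounded_minimizing_sequence[of \<tau> v "max V ((K - b) / \<eta>)" w c m])
    show "(\<lambda>n. obj \<tau> (v n) (w n) (c n)) \<longlonglongrightarrow> m"
      using lim by (simp only: obj_v)
    show "v n \<le> max V ((K - b) / \<eta>)" "w n \<le> max V ((K - b) / \<eta>)" for n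
      using V w_le by (simp_all add: le_max_iff_disj)
    fix r u' w' c'
    assume "strict_mono (r :: nat \<Rightarrow> nat)" "0 \<le> u'" "0 \<le> w'" "c' \<in> adm" "obj \<tau> u' w' c' = m"
      "(v \<circ> r) \<longlonglongrightarrow> u'" "(w \<circ> r) \<longlonglongrightarrow> w'" "AE x in P. (\<lambda>n. c (r n) x) \<longlonglongrightarrow> c' x"
    then show thesis
      using v_eq by (intro that[of r u' w' c']) auto
  qed (fact \<tau> v0 z lower)+
qed

text \<open>The direct method: coercivity makes the infimum finite, and points within
  \<open>1 / (n + 1)\<close> of it form a sequence for \<open>minimizing_sequence\<close>.\<close>

lemma obj_has_minimizer:
  assumes \<tau>: "0 \<le> \<tau>"
  obtains u w c where "0 \<le> u" "0 \<le> w" "c \<in> adm"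
    "\<And>u' w' c'. 0 \<le> u' \<Longrightarrow> 0 \<le> w' \<Longrightarrow> c' \<in> adm \<Longrightarrow> obj \<tau> u w c \<le> obj \<tau> u' w' c'"
proof -
  let ?Z = "{0::real..} \<times> {0::real..} \<times> adm"
  let ?f = "\<lambda>(u, w, c). obj \<tau> u w c"
  obtain b where b: "\<And>\<tau> u w c. 0 \<le> \<tau> \<Longrightarrow> 0 \<le> u \<Longrightarrow> 0 \<le> w \<Longrightarrow> c \<in> adm \<Longrightarrow>
       (lam / \<alpha> - lam) * u + \<eta> * w + b \<le> obj \<tau> u w c"
    using obj_coercive by blast
  have "b \<le> obj \<tau> u w c" if "0 \<le> u" "0 \<le> w" "c \<in> adm" for u w c
    using b[OF \<tau> that] that eta coeff_gap(1) mult_nonneg_nonneg[of "lam / \<alpha> - lam" u] mult_nonneg_nonneg[of \<eta> w]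
    by linarith
  then have bdd: "bdd_below (?f ` ?Z)"
    by (intro bdd_belowI[of _ b]) auto
  define m where "m = Inf (?f ` ?Z)"
  have lower: "m \<le> obj \<tau> u w c" if "0 \<le> u" "0 \<le> w" "c \<in> adm" for u w c
    unfolding m_def using cINF_lower[OF bdd, of "(u, w, c)"] that by auto
  have "(\<lambda>_. 0) \<in> adm" by (auto simp: adm_def)
  then have ne: "?Z \<noteq> {}" by auto
  have "\<exists>z\<in>?Z. ?f z < m + inverse (real (Suc n))" for n
    using cINF_less_iff[OF ne bdd, of "m + inverse (real (Suc n))"] unfolding m_def by simp
  then obtain z where z: "\<And>n. z n \<in> ?Z" "\<And>n. ?f (z n) < m + inverse (real (Suc n))"
    by metis
  define u w c where "u = (\<lambda>n. fst (z n))" "w = (\<lambda>n. fst (snd (z n)))" "c = (\<lambda>n. snd (snd (z n)))"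
  have adm: "0 \<le> u n" "0 \<le> w n" "c n \<in> adm"
    and upper: "obj \<tau> (u n) (w n) (c n) \<le> m + inverse (real (Suc n))" for n
    using z[of n] unfolding u_w_c_def by (auto simp: case_prod_beta mem_Times_iff)
  have lim: "(\<lambda>n. obj \<tau> (u n) (w n) (c n)) \<longlonglongrightarrow> m"
  proof (rule tendsto_sandwich)
    show "\<forall>\<^sub>F n in sequentially. m \<le> obj \<tau> (u n) (w n) (c n)"
      using lower adm by simp
    show "\<forall>\<^sub>F n in sequentially. obj \<tau> (u n) (w n) (c n) \<le> m + inverse (real (Suc n))"
      using upper by simp
    show "(\<lambda>n. m + inverse (real (Suc n))) \<longlonglongrightarrow> m"
      by (rule LIMSEQ_inverse_real_of_nat_add)
  qed simp
  show thesis
  proof (rule minimizing_sequence[of \<tau> u w c m])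
    fix u' w' c'
    assume "0 \<le> u'" "0 \<le> w'" "c' \<in> adm" "obj \<tau> u' w' c' = m"
    then show thesis
      using lower by (intro that[of u' w' c']) auto
  qed (fact \<tau> adm lower lim)+
qed

end

section \<open>From the density formulation to the measure formulation\<close>

text \<open>The distance to \<open>a\<close> is convex and \<open>g\<close> is increasing.
  Strictness comes from \<open>g\<close> if the two distances differ; otherwise \<open>a\<close> is
  the midpoint of \<open>s\<close> and \<open>t\<close>, and the distance drops to 0.\<close>

lemma strictly_convex_abs_midpoint:
  assumes mono: "mono_on {0..1} g" and convex: "strictly_convex_on {0..1} g"
    and a: "a \<in> {0..1}" and s: "s \<in> {0..1}" and t: "t \<in> {0..1}" and "s \<noteq> t"
  shows "g \<bar>(s + t) / 2 - a\<bar> < (g \<bar>s - a\<bar> + g \<bar>t - a\<bar>) / 2"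
proof -
  have mid: "g ((x + y) / 2) < (g x + g y) / 2" if "x \<in> {0..1}" "y \<in> {0..1}" "x \<noteq> y" for x y
  proof -
    have "g ((1 - 1/2) * x + 1/2 * y) < (1 - 1/2) * g x + 1/2 * g y"
      using convex[unfolded strictly_convex_on_def, THEN conjunct2, rule_format, of x y "1/2"] that by simp
    then show ?thesis by (simp add: add_divide_distrib)
  qed
  have d: "\<bar>s - a\<bar> \<in> {0..1}" "\<bar>t - a\<bar> \<in> {0..1}"
    using a s t by auto
  have le: "\<bar>(s + t) / 2 - a\<bar> \<le> (\<bar>s - a\<bar> + \<bar>t - a\<bar>) / 2"
    by (simp add: abs_if field_simps)
  show ?thesis
  proof (cases "\<bar>s - a\<bar> = \<bar>t - a\<bar>")
    case False
    have "g \<bar>(s + t) / 2 - a\<bar> \<le> g ((\<bar>s - a\<bar> + \<bar>t - a\<bar>) / 2)"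
      using d le by (intro mono_onD[OF mono]) auto
    also have "\<dots> < (g \<bar>s - a\<bar> + g \<bar>t - a\<bar>) / 2"
      using mid[OF d False] .
    finally show ?thesis .
  next
    case True
    then have eq: "\<bar>(s + t) / 2 - a\<bar> = 0" and pos: "\<bar>s - a\<bar> \<noteq> 0"
      using \<open>s \<noteq> t\<close> by (auto simp: abs_if field_simps split: if_splits)
    \<comment> \<open>Monotonicity and strict convexity together give
      \<open>g 0 < g \<bar>s - a\<bar>\<close>.\<close>
    have "g 0 \<le> g ((0 + \<bar>s - a\<bar>) / 2)"
      using d by (intro mono_onD[OF mono]) auto
    also have "\<dots> < (g 0 + g \<bar>s - a\<bar>) / 2"
      using d pos by (intro mid) auto
    finally show ?thesis
      using True eq by simp
  qed
qed

text \<open>Weighted set integrals become integrals over a measure. Since \<open>f'\<close> may be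
  arbitrary off \<open>S\<close>, a Borel function \<open>f\<close> that agrees with it on
  \<open>S\<close> takes its place.\<close>

lemma restricted_density:
  fixes q :: "real \<Rightarrow> real"
  assumes q: "set_borel_measurable lborel S q" "\<And>x. x \<in> S \<Longrightarrow> 0 \<le> q x"
    and f: "f \<in> borel_measurable borel" "\<And>x. x \<in> S \<Longrightarrow> f x = f' x"
  shows integral_restricted_density:
      "(LINT x:S|lborel. f' x * q x) = (\<integral>x. f x \<partial>density lborel (\<lambda>x. ennreal (indicator S x * q x)))"
    and integrable_restricted_density:
      "set_integrable lborel S (\<lambda>x. f' x * q x)
        \<longleftrightarrow> integrable (density lborel (\<lambda>x. ennreal (indicator S x * q x))) f"
proof -
  have m: "(\<lambda>x. indicator S x * q x) \<in> borel_measurable lborel" "f \<in> borel_measurable lborel"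
    using q(1) f(1) by (simp_all add: set_borel_measurable_def)
  have eq: "(\<lambda>x. indicator S x *\<^sub>R (f' x * q x)) = (\<lambda>x. (indicator S x * q x) * f x)"
    using f(2) by (auto simp: indicator_def)
  have nn: "AE x in lborel. 0 \<le> indicator S x * q x"
    using q(2) by (auto simp: indicator_def)
  show "(LINT x:S|lborel. f' x * q x) = (\<integral>x. f x \<partial>density lborel (\<lambda>x. ennreal (indicator S x * q x)))"
    unfolding set_lebesgue_integral_def eq by (rule integral_real_density[OF m(1) nn m(2), symmetric])
  show "set_integrable lborel S (\<lambda>x. f' x * q x)
      \<longleftrightarrow> integrable (density lborel (\<lambda>x. ennreal (indicator S x * q x))) f"
    unfolding set_integrable_def eq by (rule integrable_real_density[OF m(1) nn m(2), symmetric])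
qed

lemma F_fun_eq_F_reg_0: "F_fun g chat \<alpha> \<beta> lam \<eta> = F_reg g chat \<alpha> \<beta> lam \<eta> 0"
  by (intro ext) (simp add: F_fun_def F_reg_def)

lemma J_eq_J_reg_0: "J X p g chat \<alpha> \<beta> lam \<eta> \<mu> = J_reg X p g chat \<alpha> \<beta> lam \<eta> \<mu> 0"
  by (simp add: J_def J_reg_def F_fun_eq_F_reg_0)

text \<open>Accumulation is read sequentially, with controls converging in \<open>L2p_norm\<close>.
  If \<open>lam = 0\<close>, the objectives do not depend on \<open>u\<close>, so minimizers can
  have \<open>u\<close> tending to infinity; this explains the condition on the convergence of
  \<open>u\<close>. Existence of regularized minimizers is included so that the accumulation claim
  is not vacuous.\<close>

theorem proposition8:
  fixes X chat \<alpha> \<beta> lam \<eta> \<mu> :: real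
    and p g :: "real \<Rightarrow> real"
  assumes X_nonneg: "0 \<le> X"
    and p_meas: "set_borel_measurable lborel (Xi X) p"
    and p_nonneg: "\<And>x. x \<in> Xi X \<Longrightarrow> 0 \<le> p x"
    and p_bounded: "bounded (p ` Xi X)"
    and p_cont: "continuous_on (Xi X) p"
    and p_pos: "\<And>x. x \<in> Xi X \<Longrightarrow> 0 < p x"
    and p_integrable: "set_integrable lborel (Xi X) p"
    and p_prob: "(LINT x:Xi X|lborel. p x) = 1"
    and alpha: "0 < \<alpha>" "\<alpha> < 1"
    and beta: "0 < \<beta>" "\<beta> < 1"
    and chat: "0 \<le> chat" "chat \<le> 1"
    and lam: "0 \<le> lam"
    and eta: "0 \<le> \<eta>"
    and mu: "0 < \<mu>"
    and g_range: "g \<in> {0..1} \<rightarrow> {0..}"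
    and g_C2: "C2_on {0..1} g"
    and g_mono: "mono_on {0..1} g"
    and g_strict_convex: "strictly_convex_on {0..1} g"
    and g_lipschitz: "\<exists>L. L-lipschitz_on {0..1} g"
    and C_X_pos: "0 < C_X \<eta> \<mu> \<beta>"
    and C_X_small: "\<And>k::nat. k \<le> 2 \<Longrightarrow>
          set_integrable lborel (Xi X) (\<lambda>x. x ^ k * exp (C_X \<eta> \<mu> \<beta> * x) * p x)"
  shows "(W_reg X p g chat \<alpha> \<beta> lam \<eta> \<mu> \<longlongrightarrow> W_val X p g chat \<alpha> \<beta> lam \<eta> \<mu>) (at_right 0)
    \<and> (\<forall>\<tau>>0. \<exists>z. minimizer_W_reg X p g chat \<alpha> \<beta> lam \<eta> \<mu> \<tau> z)
    \<and> (\<forall>t u w c. (\<forall>n::nat. t n > 0) \<and> t \<longlonglongrightarrow> 0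
          \<and> (\<forall>n. minimizer_W_reg X p g chat \<alpha> \<beta> lam \<eta> \<mu> (t n) (u n, w n, c n)) \<longrightarrow>
        (\<exists>r u' w' c'. strict_mono (r :: nat \<Rightarrow> nat)
          \<and> minimizer_W X p g chat \<alpha> \<beta> lam \<eta> \<mu> (u', w', c')
          \<and> (lam > 0 \<or> Bseq u \<longrightarrow> (\<lambda>n. u (r n)) \<longlonglongrightarrow> u')
          \<and> (\<lambda>n. w (r n)) \<longlonglongrightarrow> w'
          \<and> (\<lambda>n. L2p_norm X p (\<lambda>x. c (r n) x - c' x)) \<longlonglongrightarrow> 0))
    \<and> (\<exists>C>0. \<forall>\<tau>>0. \<bar>W_reg X p g chat \<alpha> \<beta> lam \<eta> \<mu> \<tau> - W_val X p g chat \<alpha> \<beta> lam \<eta> \<mu>\<bar> \<le> C * \<tau>)"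
proof -
  define P where "P = density lborel (\<lambda>x. ennreal (indicator (Xi X) x * p x))"
  \<comment> \<open>Capping the argument at 1 keeps it in the domain of \<open>g\<close>, so
    \<open>h\<close> is continuous on the whole line; for \<open>s\<close> in the unit interval the
    cap has no effect.\<close>
  define h where "h = (\<lambda>s. g (min 1 \<bar>s - chat\<bar>))"
  note LINT_P = integral_restricted_density[OF p_meas p_nonneg, folded P_def]
  note integrable_P = integrable_restricted_density[OF p_meas p_nonneg, folded P_def]
  have sets_P: "sets P = sets borel" by (simp add: P_def)
  have Xi_pos: "0 < x" if "x \<in> Xi X" for x using that X_nonneg by (simp add: Xi_def)
  have pm: "(\<lambda>x. indicator (Xi X) x * p x) \<in> borel_measurable lborel"
    using p_meas by (simp add: set_borel_measurable_def)
  have AE_Xi: "AE x in P. x \<in> Xi X"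
    unfolding P_def using pm by (subst AE_density) (auto simp: indicator_def split: if_splits)
  have "emeasure P (space P) = (\<integral>\<^sup>+x. ennreal (indicator (Xi X) x * p x) \<partial>lborel)"
    unfolding P_def using pm by (subst emeasure_density) (auto intro!: nn_integral_cong)
  also have "\<dots> = ennreal (\<integral>x. indicator (Xi X) x * p x \<partial>lborel)"
    using p_integrable p_nonneg
    by (intro nn_integral_eq_integral) (auto simp: set_integrable_def indicator_def)
  also have "\<dots> = 1"
    using p_prob by (simp add: set_lebesgue_integral_def)
  finally have "prob_space P" by (rule prob_spaceI)
  \<comment> \<open>Positivity of \<open>C_X\<close> excludes \<open>\<eta> = 0\<close>; coercivity
    in \<open>w\<close> rests on this.\<close>
  have eta_pos: "0 < \<eta>"
    using C_X_pos beta mu eta by (auto simp: C_X_def zero_less_divide_iff zero_less_mult_iff)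
  interpret hedging_problem P h \<alpha> \<beta> lam \<eta> \<mu>
  proof (intro hedging_problem.intro hedging_problem_axioms.intro \<open>prob_space P\<close> sets_P)
    show "AE x in P. 0 \<le> x"
      using AE_Xi Xi_pos by (auto elim!: eventually_mono intro: less_imp_le)
    obtain L where "L-lipschitz_on {0..1} g" using g_lipschitz by blast
    then have "continuous_on {0..1} g" by (rule lipschitz_on_continuous_on)
    then show "continuous_on UNIV h"
      unfolding h_def by (rule continuous_on_compose2) (auto intro!: continuous_intros)
    show "0 \<le> h s" for s
      using g_range by (auto simp: h_def Pi_iff)
    show "h ((s + t) / 2) < (h s + h t) / 2" if st: "s \<in> {0..1}" "t \<in> {0..1}" "s \<noteq> t" for s t
    proof -
      have "min 1 \<bar>v - chat\<bar> = \<bar>v - chat\<bar>" if "v \<in> {0..1}" for v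
        using that chat by auto
      moreover have "(s + t) / 2 \<in> {0..1}" using st by auto
      ultimately show ?thesis
        unfolding h_def using strictly_convex_abs_midpoint[OF g_mono g_strict_convex _ st] chat st by simp
    qed
    \<comment> \<open>The moment condition with \<open>k = 0\<close>; the exponent required is half
      of \<open>C_X \<eta> \<mu> \<beta>\<close>, and \<open>x\<close> is positive almost
      everywhere.\<close>
    have "integrable P (\<lambda>x. exp (C_X \<eta> \<mu> \<beta> * x))"
      using C_X_small[of 0] by (subst integrable_P[OF _ _ refl, symmetric]) auto
    then show "integrable P (\<lambda>x. exp (\<eta> / (1 - \<beta>) * x / \<mu>))"
    proof (rule Bochner_Integration.integrable_bound)
      show "(\<lambda>x. exp (\<eta> / (1 - \<beta>) * x / \<mu>)) \<in> borel_measurable P"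
        unfolding measurable_cong_sets[OF sets_P refl] by measurable
      show "AE x in P. norm (exp (\<eta> / (1 - \<beta>) * x / \<mu>)) \<le> norm (exp (C_X \<eta> \<mu> \<beta> * x))"
        using AE_Xi
      proof eventually_elim
        case (elim x)
        have "\<eta> / (1 - \<beta>) * x / \<mu> = C_X \<eta> \<mu> \<beta> * x / 2"
          by (simp add: C_X_def)
        moreover have "0 \<le> C_X \<eta> \<mu> \<beta> * x"
          using C_X_pos Xi_pos[OF elim] by simp
        ultimately show ?case by simp
      qed
    qed
  qed (use alpha beta lam eta_pos mu in auto)
  let ?F = "feasible X p" and ?J = "J_reg X p g chat \<alpha> \<beta> lam \<eta> \<mu>"
  \<comment> \<open>Extension by zero turns an admissible function, of which only the values on
    \<open>Xi X\<close> matter, into an element of \<open>adm\<close>.\<close>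
  define ext0 where "ext0 = (\<lambda>c x. indicator (Xi X) x * c x :: real)"
  have ext0: "ext0 c x = c x" if "x \<in> Xi X" for c x using that by (simp add: ext0_def)
  have ext0_adm: "ext0 c \<in> adm" if "c \<in> admissible X p" for c
    using that by (auto simp: admissible_def L2p_def set_borel_measurable_def adm_def ext0_def indicator_def)
  have adm_admissible: "c \<in> admissible X p" if "c \<in> adm" for c
  proof -
    note [measurable] = admD(1)[OF that]
    have [measurable]: "Xi X \<in> sets borel" by (simp add: Xi_def)
    have "integrable P (\<lambda>x. (c x)\<^sup>2)"
      using admD[OF that] measurable_P[OF that]
      by (intro integrable_const_bound[where B = 1]) (auto simp: power_le_one)
    then have "set_integrable lborel (Xi X) (\<lambda>x. (c x)\<^sup>2 * p x)"
      by (subst integrable_P[OF _ _ refl]) auto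
    then show ?thesis
      using admD[OF that] by (auto simp: admissible_def L2p_def set_borel_measurable_def)
  qed
  \<comment> \<open>The bridge between the two formulations; \<open>c'\<close> may take any values
    off \<open>Xi X\<close>, as members of \<open>admissible X p\<close> do.\<close>
  have J_cong: "?J \<tau> (u, w, c') = obj \<tau> u w c" if "c \<in> adm" "\<And>x. x \<in> Xi X \<Longrightarrow> c x = c' x" for \<tau> u w c c'
  proof -
    have "(\<lambda>x. exp (loss \<tau> u w c x / \<mu>)) \<in> borel_measurable borel"
      using loss_measurable[OF that(1)] measurable_cong_sets[OF sets_P refl] by measurable
    moreover have "exp (loss \<tau> u w c x / \<mu>) = exp (F_reg g chat \<alpha> \<beta> lam \<eta> \<tau> x u w c' / \<mu>)" if x: "x \<in> Xi X" for x
    proof -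
      have "\<bar>c x - chat\<bar> \<le> 1" using admD(2,3)[OF \<open>c \<in> adm\<close>, of x] chat by auto
      then have "loss \<tau> u w c x = F_reg g chat \<alpha> \<beta> lam \<eta> \<tau> x u w c"
        unfolding loss_def unfolding F_reg_def h_def by (simp add: min_absorb2)
      also have "\<dots> = F_reg g chat \<alpha> \<beta> lam \<eta> \<tau> x u w c'"
        unfolding F_reg_def using \<open>\<And>x. x \<in> Xi X \<Longrightarrow> c x = c' x\<close>[OF x] by simp
      finally show ?thesis by simp
    qed
    ultimately show ?thesis
      using LINT_P by (simp add: J_reg_def obj_def partition_fun_def)
  qed
  have J_ext0: "?J \<tau> (u, w, c) = obj \<tau> u w (ext0 c)" if "c \<in> admissible X p" for \<tau> u w c
    using that by (intro J_cong ext0_adm ext0)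
  have J_adm: "?J \<tau> (u, w, c) = obj \<tau> u w c" if "c \<in> adm" for \<tau> u w c
    using that by (intro J_cong) auto
  have minimizer_iff: "is_arg_min (?J \<tau>) (\<lambda>z. z \<in> ?F) z \<longleftrightarrow> z \<in> ?F \<and> (\<forall>y\<in>?F. ?J \<tau> z \<le> ?J \<tau> y)" for \<tau> z
    by (auto simp: is_arg_min_linorder)
  have ex_min: "\<exists>z. is_arg_min (?J \<tau>) (\<lambda>z. z \<in> ?F) z" if \<tau>: "0 \<le> \<tau>" for \<tau>
  proof -
    obtain u w c where z: "0 \<le> u" "0 \<le> w" "c \<in> adm"
      "\<And>u' w' c'. 0 \<le> u' \<Longrightarrow> 0 \<le> w' \<Longrightarrow> c' \<in> adm \<Longrightarrow> obj \<tau> u w c \<le> obj \<tau> u' w' c'"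
      using obj_has_minimizer[OF \<tau>] by blast
    then have "is_arg_min (?J \<tau>) (\<lambda>z. z \<in> ?F) (u, w, c)"
      unfolding minimizer_iff by (auto simp: feasible_def adm_admissible ext0_adm J_adm J_ext0)
    then show ?thesis by blast
  qed
  \<comment> \<open>With a minimizer at hand the infimum is a minimum, so the two optimal values can
    be compared at points.\<close>
  have INF_eq: "(INF z\<in>?F. ?J \<tau> z) = ?J \<tau> z" if "is_arg_min (?J \<tau>) (\<lambda>z. z \<in> ?F) z" for \<tau> z
    using that unfolding minimizer_iff by (intro cInf_eq_minimum) auto
  define C where "C = lam / \<alpha> + \<eta> / (1 - \<beta>)"
  have C: "0 < C" using coeffs_nonneg by (simp add: C_def)
  have J_bounds: "?J 0 z \<le> ?J \<tau> z" "?J \<tau> z \<le> ?J 0 z + C * \<tau>" if "0 \<le> \<tau>" "z \<in> ?F" for \<tau> z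
    using that obj_regularization_bounds unfolding C_def
    by (auto simp: feasible_def J_ext0 ext0_adm)
  let ?W = "W_val X p g chat \<alpha> \<beta> lam \<eta> \<mu>" and ?Wr = "W_reg X p g chat \<alpha> \<beta> lam \<eta> \<mu>"
  have W_bounds: "?W \<le> ?Wr \<tau>" "?Wr \<tau> \<le> ?W + C * \<tau>" if \<tau>: "0 \<le> \<tau>" for \<tau>
  proof -
    obtain z0 z1 where z: "is_arg_min (?J 0) (\<lambda>z. z \<in> ?F) z0" "is_arg_min (?J \<tau>) (\<lambda>z. z \<in> ?F) z1"
      using ex_min \<tau> by blast
    have W: "?W = ?J 0 z0" "?Wr \<tau> = ?J \<tau> z1"
      unfolding W_val_def W_reg_def J_eq_J_reg_0 using z by (simp_all add: INF_eq)
    \<comment> \<open>Each minimizer serves as a competitor in the other problem, where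
      \<open>J_bounds\<close> applies.\<close>
    from z have "z0 \<in> ?F" "z1 \<in> ?F" "?J 0 z0 \<le> ?J 0 z1" "?J \<tau> z1 \<le> ?J \<tau> z0"
      unfolding minimizer_iff by auto
    then show "?W \<le> ?Wr \<tau>" "?Wr \<tau> \<le> ?W + C * \<tau>"
      unfolding W using J_bounds[OF \<tau>] by (blast intro: order_trans)+
  qed
  have rate: "\<bar>?Wr \<tau> - ?W\<bar> \<le> C * \<tau>" if "0 < \<tau>" for \<tau>
    using W_bounds[of \<tau>] that by auto
  have limit: "(?Wr \<longlongrightarrow> ?W) (at_right 0)"
  proof (rule tendsto_sandwich)
    show "\<forall>\<^sub>F \<tau> in at_right 0. ?W \<le> ?Wr \<tau>" "\<forall>\<^sub>F \<tau> in at_right 0. ?Wr \<tau> \<le> ?W + C * \<tau>"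
      using W_bounds by (auto simp: eventually_at_right_field intro!: exI[of _ 1])
    have "((\<lambda>\<tau>. ?W + C * \<tau>) \<longlongrightarrow> ?W + C * 0) (at_right 0)"
      by (intro tendsto_intros)
    then show "((\<lambda>\<tau>. ?W + C * \<tau>) \<longlongrightarrow> ?W) (at_right 0)" by simp
  qed simp
  have accumulation: "\<exists>r u' w' c'. strict_mono (r :: nat \<Rightarrow> nat)
          \<and> minimizer_W X p g chat \<alpha> \<beta> lam \<eta> \<mu> (u', w', c')
          \<and> (lam > 0 \<or> Bseq u \<longrightarrow> (\<lambda>n. u (r n)) \<longlonglongrightarrow> u')
          \<and> (\<lambda>n. w (r n)) \<longlonglongrightarrow> w'
          \<and> (\<lambda>n. L2p_norm X p (\<lambda>x. c (r n) x - c' x)) \<longlonglongrightarrow> 0"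
    if t: "\<And>n::nat. t n > 0" "t \<longlonglongrightarrow> 0"
      and z: "\<And>n. minimizer_W_reg X p g chat \<alpha> \<beta> lam \<eta> \<mu> (t n) (u n, w n, c n)" for t u w c
  proof -
    have z_min: "is_arg_min (?J (t n)) (\<lambda>z. z \<in> ?F) (u n, w n, c n)" for n
      using z by (simp add: minimizer_W_reg_def)
    then have zF: "(u n, w n, c n) \<in> ?F" for n
      unfolding minimizer_iff by blast
    then have feas: "0 \<le> u n" "0 \<le> w n" "c n \<in> admissible X p" "ext0 (c n) \<in> adm" for n
      by (auto simp: feasible_def ext0_adm)
    have W_le: "?W \<le> obj 0 u' w' c'" if "0 \<le> u'" "0 \<le> w'" "c' \<in> adm" for u' w' c'
    proof -
      obtain z0 where z0: "is_arg_min (?J 0) (\<lambda>z. z \<in> ?F) z0" using ex_min by blast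
      then have "?W = ?J 0 z0"
        unfolding W_val_def J_eq_J_reg_0 by (rule INF_eq)
      moreover have "?J 0 z0 \<le> ?J 0 (u', w', c')"
        using z0 that unfolding minimizer_iff by (auto simp: feasible_def adm_admissible)
      ultimately show ?thesis using J_adm[OF that(3)] by simp
    qed
    \<comment> \<open>The regularized minimizers are evaluated in the unregularized objective, so
      that \<open>\<tau>\<close> stays fixed at 0 while \<open>t n\<close> varies.\<close>
    have lim: "(\<lambda>n. obj 0 (u n) (w n) (ext0 (c n))) \<longlonglongrightarrow> ?W"
    proof (rule tendsto_sandwich)
      show "\<forall>\<^sub>F n in sequentially. ?W \<le> obj 0 (u n) (w n) (ext0 (c n))"
        using W_le feas by simp
      have "obj 0 (u n) (w n) (ext0 (c n)) \<le> ?W + C * t n" for n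
      proof -
        have "obj 0 (u n) (w n) (ext0 (c n)) = ?J 0 (u n, w n, c n)"
          using J_ext0 feas by simp
        also have "\<dots> \<le> ?J (t n) (u n, w n, c n)"
          using t(1)[of n] by (intro J_bounds zF) simp
        also have "\<dots> = ?Wr (t n)"
          unfolding W_reg_def using INF_eq[OF z_min] by simp
        also have "\<dots> \<le> ?W + C * t n"
          using t(1)[of n] by (intro W_bounds) simp
        finally show ?thesis .
      qed
      then show "\<forall>\<^sub>F n in sequentially. obj 0 (u n) (w n) (ext0 (c n)) \<le> ?W + C * t n"
        by simp
      have "(\<lambda>n. ?W + C * t n) \<longlonglongrightarrow> ?W + C * 0"
        by (intro tendsto_intros t)
      then show "(\<lambda>n. ?W + C * t n) \<longlonglongrightarrow> ?W" by simp
    qed simp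
    show ?thesis
    proof (rule minimizing_sequence[of 0 u w "\<lambda>n. ext0 (c n)" ?W])
      fix r u' w' c'
      assume r: "strict_mono (r :: nat \<Rightarrow> nat)"
        and z': "0 \<le> u'" "0 \<le> w'" "c' \<in> adm" "obj 0 u' w' c' = ?W"
        and conv: "lam > 0 \<or> Bseq u \<Longrightarrow> (u \<circ> r) \<longlonglongrightarrow> u'" "(w \<circ> r) \<longlonglongrightarrow> w'"
          "AE x in P. (\<lambda>n. ext0 (c (r n)) x) \<longlonglongrightarrow> c' x"
      have "is_arg_min (?J 0) (\<lambda>z. z \<in> ?F) (u', w', c')"
        unfolding minimizer_iff using z' W_le
        by (auto simp: feasible_def adm_admissible J_adm J_ext0 ext0_adm)
      then have "minimizer_W X p g chat \<alpha> \<beta> lam \<eta> \<mu> (u', w', c')"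
        by (simp add: minimizer_W_def J_eq_J_reg_0)
      moreover have "(\<lambda>n. L2p_norm X p (\<lambda>x. c (r n) x - c' x)) \<longlonglongrightarrow> 0"
      proof -
        note [measurable] = admD(1)[OF feas(4)] admD(1)[OF z'(3)] measurable_P[OF feas(4)] measurable_P[OF z'(3)]
        have norm_eq: "L2p_norm X p (\<lambda>x. c (r n) x - c' x) = sqrt (\<integral>x. (ext0 (c (r n)) x - c' x)\<^sup>2 \<partial>P)" for n
        proof -
          have "(\<lambda>x. (ext0 (c (r n)) x - c' x)\<^sup>2) \<in> borel_measurable borel" by measurable
          then show ?thesis
            unfolding L2p_norm_def by (subst LINT_P) (auto simp: ext0)
        qed
        \<comment> \<open>Differences of controls are bounded by 1, so dominated convergence
          upgrades almost everywhere convergence to convergence in L2.\<close>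
        have "(\<lambda>n. \<integral>x. (ext0 (c (r n)) x - c' x)\<^sup>2 \<partial>P) \<longlonglongrightarrow> (\<integral>x. 0 \<partial>P)"
        proof (rule integral_dominated_convergence[where w = "\<lambda>_. 1"])
          show "AE x in P. (\<lambda>n. (ext0 (c (r n)) x - c' x)\<^sup>2) \<longlonglongrightarrow> 0"
            using conv(3)
          proof eventually_elim
            case (elim x)
            then have "(\<lambda>n. (ext0 (c (r n)) x - c' x)\<^sup>2) \<longlonglongrightarrow> (c' x - c' x)\<^sup>2"
              by (intro tendsto_intros)
            then show ?case by simp
          qed
          show "AE x in P. norm ((ext0 (c (r n)) x - c' x)\<^sup>2) \<le> 1" for n
          proof (rule AE_I2)
            fix x
            have "\<bar>ext0 (c (r n)) x - c' x\<bar> \<le> 1"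
              using admD(2,3)[OF feas(4)[of "r n"], of x] admD(2,3)[OF z'(3), of x] by linarith
            then show "norm ((ext0 (c (r n)) x - c' x)\<^sup>2) \<le> 1"
              by (simp add: abs_square_le_1)
          qed
        qed auto
        then have "(\<lambda>n. sqrt (\<integral>x. (ext0 (c (r n)) x - c' x)\<^sup>2 \<partial>P)) \<longlonglongrightarrow> sqrt 0"
          by (intro tendsto_real_sqrt) simp
        then show ?thesis by (simp add: norm_eq)
      qed
      moreover have "lam > 0 \<or> Bseq u \<longrightarrow> (\<lambda>n. u (r n)) \<longlonglongrightarrow> u'" "(\<lambda>n. w (r n)) \<longlonglongrightarrow> w'"
        using conv(1,2) by (simp_all add: o_def)
      ultimately show ?thesis
        using r by blast
    qed (fact order_refl feas W_le lim)+
  qed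
  have existence: "\<exists>z. minimizer_W_reg X p g chat \<alpha> \<beta> lam \<eta> \<mu> \<tau> z" if "0 < \<tau>" for \<tau>
    using ex_min[of \<tau>] that by (simp add: minimizer_W_reg_def)
  show ?thesis
  proof (intro conjI allI impI)
    show "(?Wr \<longlongrightarrow> ?W) (at_right 0)"
      by (fact limit)
    show "\<exists>z. minimizer_W_reg X p g chat \<alpha> \<beta> lam \<eta> \<mu> \<tau> z" if "0 < \<tau>" for \<tau>
      using that by (rule existence)
    show "\<exists>r u' w' c'. strict_mono (r :: nat \<Rightarrow> nat)
          \<and> minimizer_W X p g chat \<alpha> \<beta> lam \<eta> \<mu> (u', w', c')
          \<and> (lam > 0 \<or> Bseq u \<longrightarrow> (\<lambda>n. u (r n)) \<longlonglongrightarrow> u')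
          \<and> (\<lambda>n. w (r n)) \<longlonglongrightarrow> w'
          \<and> (\<lambda>n. L2p_norm X p (\<lambda>x. c (r n) x - c' x)) \<longlonglongrightarrow> 0"
      if "(\<forall>n. t n > 0) \<and> t \<longlonglongrightarrow> 0
          \<and> (\<forall>n. minimizer_W_reg X p g chat \<alpha> \<beta> lam \<eta> \<mu> (t n) (u n, w n, c n))" for t u w c
      by (rule accumulation[of t u w c]) (use that in auto)
    show "\<exists>C>0. \<forall>\<tau>>0. \<bar>?Wr \<tau> - ?W\<bar> \<le> C * \<tau>"
      using rate C by (intro exI[of _ C]) simp
  qed
qed

end
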